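(* Let $S(\mathbb Z_{18})$ be the set of integer group determinants of the cyclic group $\mathbb Z_{18}$. (a) The odd $D\in S(\mathbb Z_{18})$ with $3^3\parallel D$ are exactly the integers $3^3mp$ with $p$ a Type 1 prime and $\gcd(m,6)=1$. (b) The even $D\in S(\mathbb Z_{18})$ with $3^3\parallel D$ are exactly the integers of one of the forms: $2^2\cdot 3^3 m p$ with $p$ any Type 1 prime and $\gcd(m,3)=1$; $2^4\cdot 3^3 m$ with $\gcd(m,6)=1$; $2^6\cdot 3^3 m$ with $\gcd(m,3)=1$.
   Context: For a finite group $G$ and $\sum_{g\in G}a_g g\in\mathbb Z[G]$, its group determinant is $\det\left(a_{gh^{-1}}\right)_{g,h\in G}$; $S(G)$ is the set of all such values with integer $a_g$. $3^3\parallel D$ means $3^3\mid D$, $3^4\nmid D$. Let $\omega=e^{2\pi i/3}$ and $N(a+b\omega)=a^2-ab+b^2$. A prime $p$ is a Type 1 prime if $p=N\big(2(1+3B)+3(1+2A)\omega\big)$ for some integers $A,B$ (equivalently, $p\equiv1\pmod 3$ is of the form $4x^2+2xy+7y^2$). *)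

theory Defs
  imports "HOL-Analysis.Determinants" "HOL-Library.Numeral_Type"
    "HOL-Computational_Algebra.Primes"
begin

text \<open>
  A finite group is a type of class \<^class>\<open>group_add\<close> and \<^class>\<open>finite\<close>; the class does not assume
  commutativity. The group is written additively, so \<open>g - h\<close> is the element \<open>g h\<^sup>-\<^sup>1\<close>. The cyclic
  group of order \<open>n\<close> is the additive group of the numeral type \<open>n\<close> (integers modulo \<open>n\<close>).
\<close>

definition group_det :: "('g::{group_add,finite} \<Rightarrow> int) \<Rightarrow> int" where
  "group_det a = det (\<chi> g h. a (g - h))"

definition integer_group_dets :: "'g::{group_add,finite} itself \<Rightarrow> int set" where
  "integer_group_dets _ = range (group_det :: ('g \<Rightarrow> int) \<Rightarrow> int)"

text \<open>The norm of \<open>a + b\<omega>\<close>, where \<open>\<omega> = exp (2\<pi>i/3)\<close>.\<close>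

definition eisenstein_norm :: "int \<Rightarrow> int \<Rightarrow> int" where
  "eisenstein_norm a b = a\<^sup>2 - a * b + b\<^sup>2"

definition type1_prime :: "int \<Rightarrow> bool" where
  "type1_prime p \<longleftrightarrow>
     prime p \<and> (\<exists>A B. p = eisenstein_norm (2 * (1 + 3 * B)) (3 * (1 + 2 * A)))"

end

theory Submission
  imports Defs
begin

text \<open>
  Over the complex numbers the group matrix is diagonalised by the Fourier matrix, so the determinant
  is the product of the values of \<open>F = \<Sum>a\<^sub>k x\<^sup>k\<close> at the 18th roots of unity. It equals
  \<open>det9 f * det9 g\<close> with \<open>f = F(x)\<close> and \<open>g = F(-x)\<close> modulo \<open>x\<^sup>9 - 1\<close>, and
  the only relation between the integer vectors \<open>f\<close> and \<open>g\<close> is congruence modulo 2. Each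
  \<open>det9 f\<close> is \<open>f(1)\<close> times the norms of \<open>f(\<omega>)\<close> and of the relative norm
  \<open>P\<^sub>f\<close> of \<open>f(\<zeta>\<^sub>9)\<close> in \<open>\<int>[\<omega>]\<close>.

  Divisibility of \<open>f(1)\<close> by 3 forces \<open>3\<^sup>3\<close> to divide \<open>det9 f\<close>. So if
  \<open>3\<^sup>3\<close> exactly divides the determinant, 3 divides just one of \<open>f(1)\<close>,
  \<open>g(1)\<close>, say \<open>f(1) = 3t\<close>, and then \<open>f(\<omega>) = (1 - \<omega>)\<alpha>\<close> and \<open>P\<^sub>f = (1 - \<omega>)\<beta>\<close>, where
  \<open>\<beta> \<equiv> \<alpha> - t(1 - \<omega>\<^sup>2)\<close> modulo 3, whereas
  \<open>P\<^sub>g \<equiv> g(\<omega>)\<close> modulo 3. Together with the congruences modulo 2 this prevents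
  \<open>\<alpha>\<close>, \<open>\<beta>\<close>, \<open>g(\<omega>)\<close>, \<open>P\<^sub>g\<close> from all being congruent to units
  modulo 6. Type 1 primes are exactly the norms, coprime to 6, of primes of \<open>\<int>[\<omega>]\<close> that are not
  congruent to a unit modulo 6 (equivalently, 2 is not a cubic residue), so one of them
  divides the determinant unless one of the four elements is even, in which case high powers of 2
  appear. Conversely, shifting \<open>f\<close> by \<open>2(c, d, e, c, d, e, c, d, e)\<close> changes
  \<open>f(1)\<close> and \<open>f(\<omega>)\<close> but not \<open>P\<^sub>f\<close>, so four explicit pairs
  \<open>(f, g)\<close> yield all the listed values.
\<close>

section \<open>Eisenstein integers\<close>

text \<open>Integer pairs instead of complex numbers: divisibility and congruences become integer
  arithmetic on coordinates.\<close>

datatype eis = Eis (re_part: int) (om_part: int)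

instantiation eis :: comm_ring_1
begin

definition "0 = Eis 0 0"
definition "1 = Eis 1 0"
definition "x + y = Eis (re_part x + re_part y) (om_part x + om_part y)"
definition "x - y = Eis (re_part x - re_part y) (om_part x - om_part y)"
definition "- x = Eis (- re_part x) (- om_part x)"
definition "x * y = Eis (re_part x * re_part y - om_part x * om_part y)
  (re_part x * om_part y + om_part x * re_part y - om_part x * om_part y)"

instance
  by standard (simp_all add: zero_eis_def one_eis_def plus_eis_def minus_eis_def uminus_eis_def
      times_eis_def algebra_simps)

end

lemma eis_eq_iff: "x = y \<longleftrightarrow> re_part x = re_part y \<and> om_part x = om_part y"
  by (cases x; cases y) simp

lemma eis_parts [simp]:
  "re_part 0 = 0" "om_part 0 = 0" "re_part 1 = 1" "om_part 1 = 0"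
  "re_part (x + y) = re_part x + re_part y" "om_part (x + y) = om_part x + om_part y"
  "re_part (x - y) = re_part x - re_part y" "om_part (x - y) = om_part x - om_part y"
  "re_part (- x) = - re_part x" "om_part (- x) = - om_part x"
  "re_part (x * y) = re_part x * re_part y - om_part x * om_part y"
  "om_part (x * y) = re_part x * om_part y + om_part x * re_part y - om_part x * om_part y"
  by (simp_all add: zero_eis_def one_eis_def plus_eis_def minus_eis_def uminus_eis_def times_eis_def)

lemma of_nat_parts [simp]:
  "re_part (of_nat n) = int n" "om_part (of_nat n) = 0"
  by (induction n) simp_all

lemma of_int_parts [simp]:
  "re_part (of_int n) = n" "om_part (of_int n) = 0"
  by (cases n; simp)+

lemma numeral_parts [simp]:
  "re_part (numeral n) = numeral n" "om_part (numeral n) = 0"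
  by (metis of_int_numeral of_int_parts(1), metis of_int_numeral of_int_parts(2))

definition om :: eis where "om = Eis 0 1"

lemma om_parts [simp]: "re_part om = 0" "om_part om = 1"
  by (simp_all add: om_def)

lemma om_square: "om\<^sup>2 = - 1 - om"
  by (simp add: eis_eq_iff power2_eq_square)

definition enorm :: "eis \<Rightarrow> int" where
  "enorm z = eisenstein_norm (re_part z) (om_part z)"

lemma enorm_mult: "enorm (x * y) = enorm x * enorm y"
  by (simp add: enorm_def eisenstein_norm_def power2_eq_square algebra_simps)

text \<open>The root \<open>u\<close> is a parameter because both primitive cube roots of unity get
  substituted; at either one the map is a ring homomorphism.\<close>

definition ev :: "complex \<Rightarrow> eis \<Rightarrow> complex" where
  "ev u z = of_int (re_part z) + of_int (om_part z) * u"

context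
  fixes u :: complex
  assumes u: "u\<^sup>2 = - 1 - u"
begin

lemma ev_simps:
  "ev u (x + y) = ev u x + ev u y" "ev u (x - y) = ev u x - ev u y"
  "ev u (x * y) = ev u x * ev u y" "ev u (of_int n) = of_int n" "ev u (numeral k) = numeral k"
  "ev u 1 = 1" "ev u om = u"
proof -
  have "u * u = - 1 - u" using u by (simp add: power2_eq_square)
  then show "ev u (x * y) = ev u x * ev u y"
    by (simp add: ev_def) algebra
qed (simp_all add: ev_def algebra_simps)

lemma ev_power: "ev u (x ^ n) = ev u x ^ n"
  by (induction n) (simp_all add: ev_simps)

lemma ev_norm: "ev u z * ev (u\<^sup>2) z = of_int (enorm z)"
proof -
  have "u * u = - 1 - u" using u by (simp add: power2_eq_square)
  then show ?thesis
    unfolding ev_def enorm_def eisenstein_norm_def u by (simp add: power2_eq_square) algebra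
qed

end

section \<open>The determinant as a product of norms\<close>

text \<open>Exponents are sorted modulo 3, so that f = A(x^3) + x B(x^3) + x^2 C(x^3).
  \<open>part\<close> takes the values of A, B, C at \<omega>, \<open>tot\<close> those at 1; hence
  \<open>val1 f\<close> is f(1) and \<open>val3 f\<close> is f(\<omega>).\<close>

definition part :: "(nat \<Rightarrow> int) \<Rightarrow> nat \<Rightarrow> eis" where
  "part f i = of_int (f i) + of_int (f (i + 3)) * om + of_int (f (i + 6)) * om\<^sup>2"

definition tot :: "(nat \<Rightarrow> int) \<Rightarrow> nat \<Rightarrow> int" where
  "tot f i = f i + f (i + 3) + f (i + 6)"

definition val1 :: "(nat \<Rightarrow> int) \<Rightarrow> int" where
  "val1 f = tot f 0 + tot f 1 + tot f 2"

definition val3 :: "(nat \<Rightarrow> int) \<Rightarrow> eis" where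
  "val3 f = of_int (tot f 0) + of_int (tot f 1) * om + of_int (tot f 2) * om\<^sup>2"

text \<open>
  With \<open>f = A(x\<^sup>3) + x B(x\<^sup>3) + x\<^sup>2 C(x\<^sup>3)\<close> and \<open>A, B, C\<close> evaluated at
  \<open>\<omega>\<close>, this is the norm of \<open>f(\<zeta>\<^sub>9)\<close> over \<open>\<int>[\<omega>]\<close>, that is, the
  product of \<open>f(w)\<close> over the three \<open>w\<close> with \<open>w\<^sup>3 = \<omega>\<close>.
\<close>

definition val9 :: "(nat \<Rightarrow> int) \<Rightarrow> eis" where
  "val9 f = part f 0 ^ 3 + om * part f 1 ^ 3 + om\<^sup>2 * part f 2 ^ 3
     - 3 * om * (part f 0 * part f 1 * part f 2)"

definition det9 :: "(nat \<Rightarrow> int) \<Rightarrow> int" where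
  "det9 f = val1 f * enorm (val3 f) * enorm (val9 f)"

definition peval :: "nat \<Rightarrow> (nat \<Rightarrow> int) \<Rightarrow> complex \<Rightarrow> complex" where
  "peval n f w = (\<Sum>k<n. of_int (f k) * w ^ k)"

lemma peval9_split:
  assumes "w ^ 3 = u" "u\<^sup>2 = - 1 - u"
  shows "peval 9 f w = ev u (part f 0) + ev u (part f 1) * w + ev u (part f 2) * w\<^sup>2"
proof -
  have p: "w ^ 4 = w * u" "w ^ 5 = w\<^sup>2 * u" "w ^ 6 = u\<^sup>2" "w ^ 7 = w * u\<^sup>2" "w ^ 8 = w\<^sup>2 * u\<^sup>2"
    unfolding assms(1)[symmetric] by (simp_all add: eval_nat_numeral)
  have "peval 9 f w = of_int (f 0) + of_int (f 1) * w + of_int (f 2) * w^2 + of_int (f 3) * w^3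
    + of_int (f 4) * w^4 + of_int (f 5) * w^5 + of_int (f 6) * w^6 + of_int (f 7) * w^7 + of_int (f 8) * w^8"
    by (simp add: peval_def lessThan_nat_numeral lessThan_Suc algebra_simps)
  then show ?thesis
    unfolding p assms(1) part_def
    by (simp add: ev_simps[OF assms(2)] ev_power[OF assms(2)] algebra_simps)
qed

text \<open>The three points are the cube roots of \<open>u\<close>. With x = bw and y = cw^2 the
  product is the factorisation of a^3 + x^3 + y^3 - 3axy into linear forms, and w^3 = u eliminates
  w.\<close>

lemma peval9_orbit:
  assumes "w ^ 3 = u" "u\<^sup>2 = - 1 - u"
  shows "peval 9 f w * peval 9 f (u * w) * peval 9 f (u\<^sup>2 * w) = ev u (val9 f)"
proof -
  have u3: "u ^ 3 = 1"
    using assms(2) by (simp add: power3_eq_cube power2_eq_square) algebra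
  have w: "(u * w) ^ 3 = u" "(u\<^sup>2 * w) ^ 3 = u"
  proof -
    have "(u * w) ^ 3 = u ^ 3 * w ^ 3" "(u\<^sup>2 * w) ^ 3 = (u ^ 3)\<^sup>2 * w ^ 3"
      by (simp_all add: power_mult_distrib flip: power_mult)
    then show "(u * w) ^ 3 = u" "(u\<^sup>2 * w) ^ 3 = u"
      by (simp_all add: assms(1) u3)
  qed
  note split = peval9_split[OF assms] peval9_split[OF w(1) assms(2)] peval9_split[OF w(2) assms(2)]
  have ev9: "ev u (val9 f) = ev u (part f 0) ^ 3 + u * ev u (part f 1) ^ 3 + u\<^sup>2 * ev u (part f 2) ^ 3
     - 3 * u * (ev u (part f 0) * ev u (part f 1) * ev u (part f 2))"
    by (simp add: val9_def ev_simps[OF assms(2)] ev_power[OF assms(2)])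
  have cubic: "(a + x + y) * (a + u * x + u\<^sup>2 * y) * (a + u\<^sup>2 * x + u * y)
      = a ^ 3 + x ^ 3 + y ^ 3 - 3 * (a * x * y)" for a x y
    using assms(2) by algebra
  have u4: "u ^ 4 = u"
    using u3 by (simp add: eval_nat_numeral)
  have "(a + b * w + c * w\<^sup>2) * (a + b * (u * w) + c * (u * w)\<^sup>2) * (a + b * (u\<^sup>2 * w) + c * (u\<^sup>2 * w)\<^sup>2)
    = a ^ 3 + u * b ^ 3 + u\<^sup>2 * c ^ 3 - 3 * u * (a * b * c)" for a b c
  proof -
    have "(a + b * w + c * w\<^sup>2) * (a + b * (u * w) + c * (u * w)\<^sup>2) * (a + b * (u\<^sup>2 * w) + c * (u\<^sup>2 * w)\<^sup>2)
      = (a + b * w + c * w\<^sup>2) * (a + u * (b * w) + u\<^sup>2 * (c * w\<^sup>2)) * (a + u\<^sup>2 * (b * w) + u * (c * w\<^sup>2))"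
      by (simp add: power_mult_distrib u4 mult_ac)
    also have "\<dots> = a ^ 3 + b ^ 3 * w ^ 3 + c ^ 3 * (w ^ 3)\<^sup>2 - 3 * (a * b * c) * w ^ 3"
      unfolding cubic by (simp add: eval_nat_numeral algebra_simps)
    finally show ?thesis unfolding assms(1) by (simp add: mult_ac)
  qed
  then show ?thesis
    unfolding split ev9 by blast
qed

text \<open>The exponents of \<open>\<eta>\<close> split into 0; 3 and 6; 1, 4, 7 (cube roots of
  \<open>y\<close>); and 2, 8, 5 (cube roots of \<open>y\<^sup>2\<close>). The last two orbits give
  conjugate values, hence a norm.\<close>

lemma prod_peval9:
  assumes "\<eta> ^ 3 = y" "y\<^sup>2 = - 1 - y"
  shows "(\<Prod>j<9. peval 9 f (\<eta> ^ j)) = of_int (det9 f)"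
proof -
  have y3: "y ^ 3 = 1"
    using assms(2) by (simp add: power3_eq_cube power2_eq_square) algebra
  have y2: "(y\<^sup>2)\<^sup>2 = - 1 - y\<^sup>2" "(\<eta>\<^sup>2) ^ 3 = y\<^sup>2"
    subgoal using assms(2) y3 by algebra
    subgoal by (simp flip: assms(1) power_mult)
    done
  have eta9: "\<eta> ^ 9 = 1"
    using y3 by (simp flip: assms(1) power_mult)
  have e: "\<eta> ^ 4 = y * \<eta>" "\<eta> ^ 7 = y\<^sup>2 * \<eta>" "\<eta> ^ 8 = y\<^sup>2 * \<eta>\<^sup>2" "\<eta> ^ 6 = y\<^sup>2"
    unfolding assms(1)[symmetric] by (simp_all add: eval_nat_numeral)
  have e5: "\<eta> ^ 5 = (y\<^sup>2)\<^sup>2 * \<eta>\<^sup>2"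
    unfolding assms(1)[symmetric] using eta9 by (simp add: eval_nat_numeral)
  have p1: "peval 9 f 1 = of_int (val1 f)"
    by (simp add: peval_def val1_def tot_def lessThan_nat_numeral lessThan_Suc algebra_simps)
  have p3: "peval 9 f u = ev u (val3 f)" if "u\<^sup>2 = - 1 - u" for u
  proof -
    have "u ^ 3 = 1" using that by (simp add: power3_eq_cube power2_eq_square) algebra
    then have p: "u ^ 4 = u" "u ^ 5 = u\<^sup>2" "u ^ 6 = 1" "u ^ 7 = u" "u ^ 8 = u\<^sup>2"
      by algebra+
    show ?thesis
      unfolding val3_def tot_def
      by (simp add: peval_def lessThan_nat_numeral lessThan_Suc p \<open>u ^ 3 = 1\<close> ev_simps[OF that] ev_power[OF that] algebra_simps)
  qed
  have "(\<Prod>j<9. peval 9 f (\<eta> ^ j)) = peval 9 f 1 * (peval 9 f y * peval 9 f (y\<^sup>2))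
     * (peval 9 f \<eta> * peval 9 f (y * \<eta>) * peval 9 f (y\<^sup>2 * \<eta>))
     * (peval 9 f (\<eta>\<^sup>2) * peval 9 f (y\<^sup>2 * \<eta>\<^sup>2) * peval 9 f ((y\<^sup>2)\<^sup>2 * \<eta>\<^sup>2))"
    by (simp add: lessThan_nat_numeral lessThan_Suc e e5 assms(1) mult_ac)
  also have "\<dots> = of_int (val1 f) * (ev y (val3 f) * ev (y\<^sup>2) (val3 f)) * (ev y (val9 f) * ev (y\<^sup>2) (val9 f))"
    unfolding peval9_orbit[OF assms] peval9_orbit[OF y2(2,1)] p1 p3[OF assms(2)] p3[OF y2(1)] by (simp only: mult.assoc)
  also have "\<dots> = of_int (det9 f)"
    unfolding ev_norm[OF assms(2)] det9_def by simp
  finally show ?thesis .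
qed

text \<open>A faithful additive character \<open>e\<close> of a finite ring yields, through the ring
  multiplication, a character for every \<open>j\<close>. These give eigenvectors of the group
  matrix, and orthogonality makes \<open>V\<close> invertible.\<close>

lemma group_det_fourier:
  fixes a :: "'g::{comm_ring_1,finite} \<Rightarrow> int" and e :: "'g \<Rightarrow> complex"
  assumes e0: "e 0 = 1" and add: "\<And>x y. e (x + y) = e x * e y" and inj: "\<And>x. e x = 1 \<Longrightarrow> x = 0"
  shows "of_int (group_det a) = (\<Prod>j\<in>UNIV. \<Sum>k\<in>UNIV. of_int (a k) * e (k * j))"
proof -
  define M where "M = (\<chi> g h. complex_of_int (a (g - h)))"
  define V where "V = (\<chi> g j. e (- (g * j)))"
  define W where "W = (\<chi> j h. e (j * h))"
  define eig where "eig j = (\<Sum>k\<in>UNIV. of_int (a k) * e (k * j))" for j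
  define D where "D = (\<chi> i j. if i = j then eig j else 0)"
  have orth: "(\<Sum>j\<in>UNIV. e (d * j)) = (if d = 0 then of_nat CARD('g) else 0)" for d
  proof (cases "d = 0")
    case False
    \<comment> \<open>Shifting \<open>j\<close> by 1 multiplies the sum by \<open>e d\<close>, which
      is not 1, so the sum vanishes.\<close>
    have "(\<Sum>j\<in>UNIV. e (d * j)) = (\<Sum>j\<in>UNIV. e (d * (j + 1)))"
      by (rule sum.reindex_bij_witness[of _ "\<lambda>j. j + 1" "\<lambda>j. j - 1"]) auto
    also have "\<dots> = (\<Sum>j\<in>UNIV. e (d * j)) * e d"
      by (simp add: distrib_left add sum_distrib_right)
    finally show ?thesis
      using inj[of d] False by auto
  qed (simp add: e0)
  have "V ** W = (\<chi> i j. if i = j then of_nat CARD('g) else 0)"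
  proof -
    have "(\<Sum>j\<in>UNIV. e (- (g * j)) * e (j * h)) = (\<Sum>j\<in>UNIV. e ((h - g) * j))" for g h
      by (simp add: algebra_simps flip: add)
    then show ?thesis
      by (simp add: V_def W_def matrix_matrix_mult_def orth vec_eq_iff)
  qed
  then have "det V * det W = of_nat CARD('g) ^ CARD('g)"
    by (simp add: det_diagonal flip: det_mul)
  then have V: "det V \<noteq> 0"
    by auto
  have "M ** V = V ** D"
  proof -
    have "(\<Sum>h\<in>UNIV. of_int (a (g - h)) * e (- (h * j))) = e (- (g * j)) * eig j" for g j
    proof -
      have "(\<Sum>h\<in>UNIV. of_int (a (g - h)) * e (- (h * j))) = (\<Sum>k\<in>UNIV. of_int (a k) * e (- ((g - k) * j)))"
        by (rule sum.reindex_bij_witness[of _ "\<lambda>k. g - k" "\<lambda>h. g - h"]) auto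
      also have "\<dots> = (\<Sum>k\<in>UNIV. e (- (g * j)) * (of_int (a k) * e (k * j)))"
        by (rule sum.cong) (auto simp: algebra_simps simp flip: add)
      finally show ?thesis
        by (simp add: eig_def sum_distrib_left)
    qed
    then show ?thesis
      by (simp add: M_def V_def D_def matrix_matrix_mult_def vec_eq_iff if_distrib cong: if_cong)
  qed
  then have "det M * det V = det V * det D"
    by (metis det_mul)
  then have "det M = det D"
    using V by simp
  moreover have "det M = of_int (group_det a)"
    by (simp add: M_def group_det_def det_def)
  moreover have "det D = (\<Prod>j\<in>UNIV. eig j)"
    by (simp add: D_def det_diagonal)
  ultimately show ?thesis
    by (simp add: eig_def)
qed

section \<open>The cyclic group of order 18\<close>

lemma root_of_unity_18:
  obtains \<zeta> :: complex where "\<And>k. \<zeta> ^ k = 1 \<longleftrightarrow> 18 dvd k"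
proof
  let ?z = "cis (2 * pi / 18)"
  have 18: "?z ^ 18 = 1"
    by (simp add: DeMoivre)
  have inj: "inj_on (\<lambda>k. cis (2 * pi * real k / real 18)) {..<18}"
    using bij_betw_roots_unity[of 18] by (auto simp: bij_betw_def)
  have z: "?z ^ k = cis (2 * pi * real k / real 18)" for k
    by (simp add: DeMoivre field_simps)
  show "?z ^ k = 1 \<longleftrightarrow> 18 dvd k" for k
  proof -
    have "?z ^ k = ?z ^ (18 * (k div 18) + k mod 18)"
      by simp
    also have "\<dots> = ?z ^ (k mod 18)"
      unfolding power_add power_mult 18 by simp
    finally have "?z ^ k = 1 \<longleftrightarrow> ?z ^ (k mod 18) = ?z ^ 0"
      by simp
    also have "\<dots> \<longleftrightarrow> k mod 18 = 0"
      using inj_on_eq_iff[OF inj, of "k mod 18" 0] unfolding z by simp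
    finally show ?thesis
      by (simp add: dvd_eq_mod_eq_0)
  qed
qed

lemma bij_betw_of_nat_18: "bij_betw (of_nat :: nat \<Rightarrow> 18) {..<18} UNIV"
  and nat_Rep_of_nat_18: "nat (Rep_bit0 (of_nat k :: 18)) = k mod 18"
proof -
  show *: "nat (Rep_bit0 (of_nat k :: 18)) = k mod 18" for k
    using bit0.of_nat_eq[where 'a = 9, of k] bit0.Rep_Abs_mod[where 'a = 9, of "int k"] by (simp add: nat_mod_distrib)
  have "inj_on (of_nat :: nat \<Rightarrow> 18) {..<18}"
    by (rule inj_onI) (metis * lessThan_iff mod_less)
  then show "bij_betw (of_nat :: nat \<Rightarrow> 18) {..<18} UNIV"
    unfolding bij_betw_def by (intro conjI card_subset_eq) (simp_all add: card_image)
qed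

lemma of_int_group_det_18:
  fixes a :: "18 \<Rightarrow> int"
  assumes \<zeta>: "\<And>k. \<zeta> ^ k = 1 \<longleftrightarrow> 18 dvd k"
  shows "of_int (group_det a) = (\<Prod>j<18. peval 18 (\<lambda>k. a (of_nat k)) (\<zeta> ^ j))"
proof -
  define e where "e x = \<zeta> ^ nat (Rep_bit0 x)" for x :: 18
  have \<zeta>18: "\<zeta> ^ (k mod 18) = \<zeta> ^ k" for k
  proof -
    have "\<zeta> ^ k = \<zeta> ^ (18 * (k div 18) + k mod 18)" by simp
    then show ?thesis
      unfolding power_add power_mult using \<zeta>[of 18] by simp
  qed
  have e: "e (of_nat k) = \<zeta> ^ k" for k
    by (simp add: e_def nat_Rep_of_nat_18 \<zeta>18)
  have surj: "\<exists>k<18. x = of_nat k" for x :: 18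
    using bij_betw_of_nat_18 unfolding bij_betw_def by (metis UNIV_I imageE lessThan_iff)
  have "of_int (group_det a) = (\<Prod>j\<in>UNIV. \<Sum>k\<in>UNIV. of_int (a k) * e (k * j))"
  proof (rule group_det_fourier)
    show "e 0 = 1" using e[of 0] by simp
    show "e (x + y) = e x * e y" for x y
      by (metis surj e of_nat_add power_add)
    show "x = 0" if "e x = 1" for x
    proof -
      obtain k where "k < 18" "x = of_nat k" using surj by blast
      then show ?thesis using that by (cases "k = 0") (auto simp: e \<zeta> dest: dvd_imp_le)
    qed
  qed
  also have "\<dots> = (\<Prod>j<18. \<Sum>k<18. of_int (a (of_nat k)) * e (of_nat k * of_nat j))"
    by (simp add: sum.reindex_bij_betw[OF bij_betw_of_nat_18, symmetric]
        prod.reindex_bij_betw[OF bij_betw_of_nat_18, symmetric])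
  also have "\<dots> = (\<Prod>j<18. peval 18 (\<lambda>k. a (of_nat k)) (\<zeta> ^ j))"
    unfolding peval_def of_nat_mult[symmetric] e by (simp add: mult.commute flip: power_mult)
  finally show ?thesis .
qed

text \<open>The 18th roots of unity are w and -w with w^9 = 1. At w the coefficients at k and k + 9
  add up; at -w they are subtracted, with the sign (-1)^k.\<close>

lemma group_det_18:
  fixes a :: "18 \<Rightarrow> int"
  defines "c \<equiv> \<lambda>k. a (of_nat k)"
  shows "group_det a = det9 (\<lambda>k. c k + c (k + 9)) * det9 (\<lambda>k. (-1) ^ k * (c k - c (k + 9)))"
proof -
  obtain \<zeta> :: complex where \<zeta>: "\<And>k. \<zeta> ^ k = 1 \<longleftrightarrow> 18 dvd k"
    using root_of_unity_18 by metis
  have z9: "\<zeta> ^ 9 = - 1"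
  proof -
    have "(\<zeta> ^ 9)\<^sup>2 = 1" "\<zeta> ^ 9 \<noteq> 1"
      using \<zeta>[of 18] \<zeta>[of 9] by (simp_all flip: power_mult)
    then show ?thesis
      unfolding power2_eq_1_iff by blast
  qed
  \<comment> \<open>As \<zeta>^9 = -1, this is \<zeta>^10, a primitive 9th root of unity.\<close>
  define \<eta> where "\<eta> = - \<zeta>"
  have eta9: "\<eta> ^ 9 = 1"
    by (simp add: \<eta>_def z9)
  have y: "(\<eta> ^ 3)\<^sup>2 = - 1 - \<eta> ^ 3"
  proof -
    have "\<eta> ^ 3 \<noteq> 1"
    proof
      assume "\<eta> ^ 3 = 1"
      then have "(\<eta> ^ 3)\<^sup>2 = 1" by simp
      then show False using \<zeta>[of 6] by (simp add: \<eta>_def flip: power_mult)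
    qed
    moreover have "(\<eta> ^ 3 - 1) * ((\<eta> ^ 3)\<^sup>2 + \<eta> ^ 3 + 1) = 0"
      using eta9 by (simp add: algebra_simps eval_nat_numeral)
    ultimately have "(\<eta> ^ 3)\<^sup>2 + \<eta> ^ 3 + 1 = 0"
      by (metis eq_iff_diff_eq_0 mult_eq_0_iff)
    then show ?thesis
      by (metis add.assoc add.commute add_diff_cancel_right' diff_0 minus_add_distrib uminus_add_conv_diff)
  qed
  have w9: "(\<eta> ^ j) ^ 9 = 1" for j
    by (metis eta9 mult.commute power_mult power_one)
  have split: "peval 18 c w = peval 9 (\<lambda>k. c k + c (k + 9)) w"
    "peval 18 c (- w) = peval 9 (\<lambda>k. (-1) ^ k * (c k - c (k + 9))) w" if "w ^ 9 = 1" for w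
  proof -
    have p: "w ^ (k + 9) = w ^ k" for k
      using that by (simp add: power_add)
    have "peval 18 c v = (\<Sum>k<9. of_int (c k) * v ^ k + of_int (c (k + 9)) * v ^ (k + 9))" for v
      using sum.nat_group[of "\<lambda>k. of_int (c k) * v ^ k" 9 2]
      by (simp add: peval_def lessThan_nat_numeral lessThan_Suc algebra_simps)
    moreover have "of_int (c k) * w ^ k + of_int (c (k + 9)) * w ^ (k + 9) = of_int (c k + c (k + 9)) * w ^ k"
      "of_int (c k) * (- w) ^ k + of_int (c (k + 9)) * (- w) ^ (k + 9)
        = of_int ((-1) ^ k * (c k - c (k + 9))) * w ^ k" for k
      by (simp_all add: p uminus_power_if algebra_simps)
    ultimately show "peval 18 c w = peval 9 (\<lambda>k. c k + c (k + 9)) w"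
      "peval 18 c (- w) = peval 9 (\<lambda>k. (-1) ^ k * (c k - c (k + 9))) w"
      by (simp_all only: peval_def[of 9])
  qed
  have "of_int (group_det a) = (\<Prod>j<18. peval 18 c (\<zeta> ^ j))"
    unfolding c_def by (rule of_int_group_det_18[OF \<zeta>])
  also have "\<dots> = (\<Prod>j<9. peval 18 c (\<zeta> ^ j) * peval 18 c (\<zeta> ^ (j + 9)))"
    by (simp add: lessThan_nat_numeral lessThan_Suc mult_ac)
  also have "\<dots> = (\<Prod>j<9. peval 18 c (\<eta> ^ j) * peval 18 c (- (\<eta> ^ j)))"
    by (rule prod.cong) (auto simp: \<eta>_def power_add z9 power_minus[of \<zeta>] uminus_power_if)
  also have "\<dots> = (\<Prod>j<9. peval 9 (\<lambda>k. c k + c (k + 9)) (\<eta> ^ j))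
      * (\<Prod>j<9. peval 9 (\<lambda>k. (-1) ^ k * (c k - c (k + 9))) (\<eta> ^ j))"
    by (simp add: split[OF w9] prod.distrib)
  also have "\<dots> = of_int (det9 (\<lambda>k. c k + c (k + 9)) * det9 (\<lambda>k. (-1) ^ k * (c k - c (k + 9))))"
    unfolding prod_peval9[OF refl y] by simp
  finally show ?thesis
    unfolding of_int_eq_iff .
qed

lemma det9_cong: "(\<And>k. k < 9 \<Longrightarrow> f k = g k) \<Longrightarrow> det9 f = det9 g"
  by (simp add: det9_def val1_def val3_def val9_def tot_def part_def)

lemma integer_group_dets_18:
  "integer_group_dets TYPE(18) = {det9 f * det9 g | f g. \<forall>k<9. even (f k - g k)}"
proof (intro equalityI subsetI)
  fix D assume "D \<in> integer_group_dets TYPE(18)"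
  then obtain a :: "18 \<Rightarrow> int" where "D = group_det a"
    by (auto simp: integer_group_dets_def)
  moreover have "even (x + y - (-1) ^ k * (x - y))" for x y :: int and k :: nat
    by (cases "even k") auto
  ultimately show "D \<in> {det9 f * det9 g | f g. \<forall>k<9. even (f k - g k)}"
    unfolding group_det_18 by blast
next
  fix D assume "D \<in> {det9 f * det9 g | f g. \<forall>k<9. even (f k - g k)}"
  then obtain f g where D: "D = det9 f * det9 g" and fg: "\<And>k. k < 9 \<Longrightarrow> even (f k - g k)"
    by blast
  \<comment> \<open>Undoing the sign of x -> -x leaves plain sums \<open>f\<close> and differences
    \<open>h\<close>. Their parities still agree, so the half-sum and half-difference in
    \<open>c\<close> are integers.\<close>
  define h where "h k = (-1) ^ k * g k" for k
  have fh: "even (f k + h k)" "even (f k - h k)" if "k < 9" for k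
    using fg[OF that] by (cases "even k"; simp add: h_def)+
  define c where "c k = (if k < 9 then (f k + h k) div 2 else (f (k - 9) - h (k - 9)) div 2)" for k
  define a :: "18 \<Rightarrow> int" where "a x = c (nat (Rep_bit0 x))" for x
  have a: "a (of_nat k) = c (k mod 18)" for k
    by (simp add: a_def nat_Rep_of_nat_18)
  have sums: "a (of_nat k) + a (of_nat (k + 9)) = f k" "a (of_nat k) - a (of_nat (k + 9)) = h k" if k: "k < 9" for k
  proof -
    obtain u v where "f k + h k = 2 * u" "f k - h k = 2 * v"
      using fh[OF k] by (metis evenE)
    then show "a (of_nat k) + a (of_nat (k + 9)) = f k" "a (of_nat k) - a (of_nat (k + 9)) = h k"
      unfolding a using k by (simp_all add: c_def)
  qed
  have "det9 (\<lambda>k. a (of_nat k) + a (of_nat (k + 9))) = det9 f"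
    by (rule det9_cong) (rule sums)
  moreover have "det9 (\<lambda>k. (-1) ^ k * (a (of_nat k) - a (of_nat (k + 9)))) = det9 g"
  proof (rule det9_cong)
    show "(-1) ^ k * (a (of_nat k) - a (of_nat (k + 9))) = g k" if "k < 9" for k
      unfolding sums(2)[OF that] by (simp add: h_def uminus_power_if)
  qed
  ultimately have "group_det a = D"
    unfolding group_det_18 D by simp
  then show "D \<in> integer_group_dets TYPE(18)"
    by (auto simp: integer_group_dets_def)
qed

section \<open>Type 1 primes and residues modulo 6\<close>

lemma numeral_dvd_eis_iff:
  "(numeral k :: eis) dvd z \<longleftrightarrow> numeral k dvd re_part z \<and> numeral k dvd om_part z"
proof
  assume "numeral k dvd re_part z \<and> numeral k dvd om_part z"
  then obtain a b where "re_part z = numeral k * a" "om_part z = numeral k * b"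
    by (auto elim!: dvdE)
  then have "z = numeral k * Eis a b"
    by (simp add: eis_eq_iff)
  then show "numeral k dvd z" by simp
qed (auto elim!: dvdE)

lemma enorm_alt: "4 * enorm z = (2 * re_part z - om_part z)\<^sup>2 + 3 * (om_part z)\<^sup>2"
  by (simp add: enorm_def eisenstein_norm_def power2_eq_square algebra_simps)

lemma enorm_nonneg: "enorm z \<ge> 0"
  using enorm_alt[of z] by (smt (verit) zero_le_power2)

lemma enorm_numeral: "enorm (numeral n) = (numeral n)\<^sup>2"
  by (simp add: enorm_def eisenstein_norm_def)

lemma even_enorm_iff: "even (enorm z) \<longleftrightarrow> 2 dvd z"
  by (auto simp: enorm_def eisenstein_norm_def numeral_dvd_eis_iff)

lemma enorm_even_imp_4_dvd: "even (enorm z) \<Longrightarrow> 4 dvd enorm z"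
  by (auto simp: even_enorm_iff enorm_mult enorm_numeral elim!: dvdE)

text \<open>Reduction modulo 1 - \<omega>, the prime above 3, sends \<omega> to 1.\<close>

lemma three_dvd_enorm_iff: "3 dvd enorm z \<longleftrightarrow> 3 dvd re_part z + om_part z"
proof -
  have "enorm z = (re_part z + om_part z)\<^sup>2 + 3 * (- re_part z * om_part z)"
    by (simp add: enorm_def eisenstein_norm_def power2_eq_square algebra_simps)
  then have "3 dvd enorm z \<longleftrightarrow> 3 dvd (re_part z + om_part z)\<^sup>2"
    by (metis dvd_add_left_iff dvd_triv_left)
  then show ?thesis
    by (simp add: prime_dvd_power_iff)
qed

lemma three_dvd_enormE:
  assumes "3 dvd enorm z"
  obtains w where "z = (1 - om) * w" "enorm z = 3 * enorm w"
proof -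
  obtain b where "re_part z + om_part z = 3 * b"
    using assms by (auto simp: three_dvd_enorm_iff elim: dvdE)
  then have "z = (1 - om) * Eis (re_part z - b) b"
    by (simp add: eis_eq_iff)
  moreover have "enorm (1 - om) = 3"
    by (simp add: enorm_def eisenstein_norm_def)
  ultimately show ?thesis
    using that enorm_mult by metis
qed

text \<open>Multiplication by \<open>2 + om\<close>, the conjugate of 1 - \<omega>, turns 1 -
  \<omega> into 3, which cancels in each coordinate.\<close>

lemma one_minus_om_cancel:
  fixes x y :: eis
  assumes "(1 - om) * x = (1 - om) * y"
  shows "x = y"
proof -
  have "(2 + om) * ((1 - om) * z) = 3 * z" for z
    by (simp add: eis_eq_iff)
  then have "3 * x = 3 * y"
    using assms by metis
  then show ?thesis
    by (simp add: eis_eq_iff)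
qed

section \<open>Congruence to a unit modulo 6\<close>

definition eis_units :: "eis set" where
  "eis_units = {1, - 1, om, - om, 1 + om, - 1 - om}"

definition near_unit :: "eis \<Rightarrow> bool" where
  "near_unit z \<longleftrightarrow> (\<exists>u\<in>eis_units. 6 dvd z - u)"

text \<open>Used in contrapositive form: a product that is not a near unit has a factor that is
  none. The descent in \<open>type1_prime_dvd_enorm\<close> rests on this.\<close>

lemma near_unit_mult:
  assumes "near_unit x" "near_unit y"
  shows "near_unit (x * y)"
proof -
  obtain u v where u: "u \<in> eis_units" "6 dvd x - u" and v: "v \<in> eis_units" "6 dvd y - v"
    using assms by (auto simp: near_unit_def)
  have "x * y - u * v = (x - u) * y + u * (y - v)"
    by (simp add: algebra_simps)
  then have "6 dvd x * y - u * v"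
    using u(2) v(2) by (simp only: dvd_add dvd_mult dvd_mult2)
  moreover have "u * v \<in> eis_units"
    using u(1) v(1) unfolding eis_units_def
    by (elim insertE emptyE; simp add: eis_eq_iff)
  ultimately show ?thesis
    by (auto simp: near_unit_def)
qed

lemma eis_units_cong_3: "u \<in> eis_units \<Longrightarrow> v \<in> eis_units \<Longrightarrow> 3 dvd u - v \<Longrightarrow> u = v"
  unfolding eis_units_def by (elim insertE emptyE; simp add: numeral_dvd_eis_iff)

text \<open>Modulo 2 the ring is the field of four elements, where 1 - \<omega> is invertible and
  the six units collapse into three pairs u, -u.\<close>

lemma eis_units_cong_2:
  "u \<in> eis_units \<Longrightarrow> v \<in> eis_units \<Longrightarrow> 2 dvd (1 - om) * (u - v) \<Longrightarrow> u = v \<or> u = - v"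
  unfolding eis_units_def by (elim insertE emptyE; simp add: numeral_dvd_eis_iff eis_eq_iff)

text \<open>For the units a, b, c, d nearby, modulo 3 gives c = d, and then modulo 2 gives a = b or
  a = -b. If a = b, then 3 divides t(2 + \<omega>), hence t. If a = -b, the last congruence would
  make a unit divisible by 1 - \<omega>, which divides 2 + \<omega>.\<close>

lemma not_all_near_unit:
  assumes "near_unit \<alpha>" "near_unit \<beta>" "near_unit \<gamma>" "near_unit \<delta>"
    and "2 dvd (1 - om) * \<alpha> - \<gamma>" "2 dvd (1 - om) * \<beta> - \<delta>" "3 dvd \<delta> - \<gamma>"
    and "3 dvd \<beta> - \<alpha> + of_int t * (2 + om)"
  shows "3 dvd t"
proof -
  obtain a b c d where units: "a \<in> eis_units" "b \<in> eis_units" "c \<in> eis_units" "d \<in> eis_units"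
    and "6 dvd \<alpha> - a" "6 dvd \<beta> - b" "6 dvd \<gamma> - c" "6 dvd \<delta> - d"
    using assms(1-4) unfolding near_unit_def by blast
  then obtain \<alpha>' \<beta>' \<gamma>' \<delta>' where
    eq: "\<alpha> = a + 6 * \<alpha>'" "\<beta> = b + 6 * \<beta>'" "\<gamma> = c + 6 * \<gamma>'" "\<delta> = d + 6 * \<delta>'"
    unfolding dvd_def by (metis add.commute diff_add_cancel)
  have red: "n dvd x" if "n dvd y" "y = x + 6 * w" "n dvd 6" for n x y w :: eis
    using that by (metis dvd_add_left_iff dvd_mult2)
  have d23: "(2::eis) dvd 6" "(3::eis) dvd 6"
    by (simp_all add: numeral_dvd_eis_iff)
  have "3 dvd d - c"
    by (rule red[OF assms(7) _ d23(2), of _ "\<delta>' - \<gamma>'"]) (simp add: eq algebra_simps)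
  then have cd: "d = c"
    using eis_units_cong_3 units by blast
  have "2 dvd (1 - om) * a - c"
    by (rule red[OF assms(5) _ d23(1), of _ "(1 - om) * \<alpha>' - \<gamma>'"]) (simp add: eq algebra_simps)
  moreover have "2 dvd (1 - om) * b - d"
    by (rule red[OF assms(6) _ d23(1), of _ "(1 - om) * \<beta>' - \<delta>'"]) (simp add: eq algebra_simps)
  ultimately have "2 dvd ((1 - om) * a - c) - ((1 - om) * b - d)"
    by (rule dvd_diff)
  then have "2 dvd (1 - om) * (a - b)"
    by (simp add: cd algebra_simps)
  then have ab: "a = b \<or> a = - b"
    using eis_units_cong_2 units by blast
  have "3 dvd b - a + of_int t * (2 + om)"
    by (rule red[OF assms(8) _ d23(2), of _ "\<beta>' - \<alpha>'"]) (simp add: eq algebra_simps)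
  then show ?thesis
  proof -
    have dvd: "3 dvd re_part b - re_part a + t * 2" "3 dvd om_part b - om_part a + t"
      using \<open>3 dvd b - a + of_int t * (2 + om)\<close> by (simp_all add: numeral_dvd_eis_iff)
    have "(re_part a, om_part a) \<in> {(1,0), (-1,0), (0,1), (0,-1), (1,1), (-1,-1)}"
      using units(1) by (auto simp: eis_units_def)
    then have "re_part a = om_part a \<or> re_part a = 0 \<or> om_part a = 0"
      by auto
    moreover have "re_part b = re_part a \<and> om_part b = om_part a \<or>
        re_part b = - re_part a \<and> om_part b = - om_part a"
      using ab by auto
    \<comment> \<open>Opposite signs give t \<equiv> r and t \<equiv> 2s modulo 3; each of the three
      shapes of a unit then makes 3 divide t, so both signs end in the same conclusion.\<close>
    moreover have "3 dvd t" if "3 dvd r' - r + t * 2" "3 dvd s' - s + t"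
      "r = s \<or> r = 0 \<or> s = 0" "r' = r \<and> s' = s \<or> r' = - r \<and> s' = - s" for r s r' s' :: int
    proof -
      have "3 dvd (s' - s + t) - (r' - r + t * 2)"
        using that(1,2) by (rule dvd_diff[rotated])
      then show ?thesis
        using that by (elim disjE conjE; simp; presburger)
    qed
    ultimately show ?thesis
      using dvd by blast
  qed
qed

text \<open>The hypotheses make a + b\<omega> prime to 6. Three invertible classes modulo 2 and six
  modulo 3 give 18 classes; the first six are those of the units.\<close>

lemma mod_6_classes:
  assumes "odd a \<or> odd b" "\<not> 3 dvd a + (b::int)"
  shows "(a mod 6, b mod 6) \<in> {(1,0), (5,0), (0,1), (0,5), (1,1), (5,5)} \<union>
    {(2,3), (4,3), (3,5), (3,1), (1,4), (5,2), (5,3), (1,3), (3,2), (3,4), (4,1), (2,5)}"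
proof -
  have key: "(r, s) \<in> {(1,0), (5,0), (0,1), (0,5), (1,1), (5,5)} \<union>
    {(2,3), (4,3), (3,5), (3,1), (1,4), (5,2), (5,3), (1,3), (3,2), (3,4), (4,1), (2,5)}"
    if "r \<in> {0,1,2,3,4,5}" "s \<in> {0,1,2,3,4,5}" "odd r \<or> odd s" "\<not> 3 dvd r + s" for r s :: int
    using that by (elim insertE emptyE; simp)
  show ?thesis
  proof (rule key)
    show "a mod 6 \<in> {0,1,2,3,4,5}" "b mod 6 \<in> {0,1,2,3,4,5}"
      by auto
    show "odd (a mod 6) \<or> odd (b mod 6)"
      using assms(1) by (simp add: dvd_mod_iff)
    have "3 dvd (6 * q + r) + (6 * q' + r') \<longleftrightarrow> 3 dvd r + r'" for q r q' r' :: int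
      by presburger
    from this[of "a div 6" "a mod 6" "b div 6" "b mod 6"] show "\<not> 3 dvd a mod 6 + b mod 6"
      using assms(2) by simp
  qed
qed

text \<open>
  The last twelve classes of \<open>mod_6_classes\<close> form the orbit of \<open>2 + 3\<omega>\<close> under units and
  conjugation, which preserve the norm.
\<close>

lemma not_near_unit_enorm:
  assumes "odd (enorm z)" "\<not> 3 dvd enorm z" "\<not> near_unit z"
  obtains A B where "enorm z = eisenstein_norm (2 * (1 + 3 * B)) (3 * (1 + 2 * A))"
proof -
  define a b where "a = re_part z" and "b = om_part z"
  have z: "enorm z = eisenstein_norm a b"
    by (simp add: a_def b_def enorm_def)
  have "odd a \<or> odd b"
    using assms(1) by (auto simp: z eisenstein_norm_def)
  moreover have "\<not> 3 dvd a + b"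
    using assms(2) by (simp add: three_dvd_enorm_iff a_def b_def)
  ultimately have cl: "(a mod 6, b mod 6) \<in> {(1,0), (5,0), (0,1), (0,5), (1,1), (5,5)} \<union>
    {(2,3), (4,3), (3,5), (3,1), (1,4), (5,2), (5,3), (1,3), (3,2), (3,4), (4,1), (2,5)}"
    by (rule mod_6_classes)
  have "(a mod 6, b mod 6) \<notin> {(1,0), (5,0), (0,1), (0,5), (1,1), (5,5)}"
  proof
    assume "(a mod 6, b mod 6) \<in> {(1,0), (5,0), (0,1), (0,5), (1,1), (5,5)}"
    then have "\<exists>u\<in>eis_units. a mod 6 = re_part u mod 6 \<and> b mod 6 = om_part u mod 6"
      unfolding eis_units_def by auto
    then have "\<exists>u\<in>eis_units. 6 dvd a - re_part u \<and> 6 dvd b - om_part u"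
      unfolding mod_eq_dvd_iff .
    then show False
      using assms(3) by (auto simp: near_unit_def numeral_dvd_eis_iff a_def b_def)
  qed
  then have cl: "(a mod 6, b mod 6) \<in> {(2,3), (4,3), (3,5), (3,1), (1,4), (5,2), (5,3), (1,3), (3,2), (3,4), (4,1), (2,5)}"
    using cl by (simp only: Un_iff simp_thms)
  have *: "\<exists>A B. enorm z = eisenstein_norm (2 * (1 + 3 * B)) (3 * (1 + 2 * A))"
    if "x mod 6 = 2" "y mod 6 = 3" "eisenstein_norm x y = eisenstein_norm a b" for x y
  proof (intro exI)
    have "x = 2 * (1 + 3 * (x div 6))" "y = 3 * (1 + 2 * (y div 6))"
      using that(1,2) by presburger+
    then show "enorm z = eisenstein_norm (2 * (1 + 3 * (x div 6))) (3 * (1 + 2 * (y div 6)))"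
      using that(3) z by simp
  qed
  note N = eisenstein_norm_def power2_eq_square algebra_simps
  have "\<exists>A B. enorm z = eisenstein_norm (2 * (1 + 3 * B)) (3 * (1 + 2 * A))"
    using cl
    apply (simp only: insert_iff empty_iff prod.inject simp_thms)
    apply (elim disjE conjE)
    subgoal by (rule *[of a b]) simp_all
    subgoal by (rule *[of "- a" "- b"]) (presburger, presburger, simp add: N)
    subgoal by (rule *[of "b - a" "- a"]) (presburger, presburger, simp add: N)
    subgoal by (rule *[of "a - b" a]) (presburger, presburger, simp add: N)
    subgoal by (rule *[of "- b" "a - b"]) (presburger, presburger, simp add: N)
    subgoal by (rule *[of b "b - a"]) (presburger, presburger, simp add: N)
    subgoal by (rule *[of "a - b" "- b"]) (presburger, presburger, simp add: N)
    subgoal by (rule *[of "b - a" b]) (presburger, presburger, simp add: N)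
    subgoal by (rule *[of b a]) (presburger, presburger, simp add: N)
    subgoal by (rule *[of "- b" "- a"]) (presburger, presburger, simp add: N)
    subgoal by (rule *[of "- a" "b - a"]) (presburger, presburger, simp add: N)
    subgoal by (rule *[of a "a - b"]) (presburger, presburger, simp add: N)
    done
  then show ?thesis
    using that by blast
qed

section \<open>Prime elements and descent\<close>

lemma eisenstein_norm_type1_gt_1: "eisenstein_norm x (3 * (1 + 2 * A)) > 1"
proof -
  have "4 * eisenstein_norm x y = (2 * x - y)\<^sup>2 + 3 * y\<^sup>2" for y
    by (simp add: eisenstein_norm_def power2_eq_square algebra_simps)
  moreover have "3 * 3 \<le> \<bar>3 * (1 + 2 * A)\<bar> * \<bar>3 * (1 + 2 * A)\<bar>"
    by (rule mult_mono) presburger+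
  then have "(3 * (1 + 2 * A))\<^sup>2 \<ge> 9"
    by (simp add: power2_eq_square)
  ultimately show ?thesis
    by (smt (verit) zero_le_power2)
qed

text \<open>Pigeonhole: with k the integer part of the square root of p, there are (k + 1)^2 > p
  pairs but only p residues of bx - ay; two colliding pairs are subtracted. The bounds are strict
  since a prime is no square.\<close>

lemma thue:
  fixes p a b :: int
  assumes "prime p"
  obtains x y where "x \<noteq> 0 \<or> y \<noteq> 0" "x\<^sup>2 < p" "y\<^sup>2 < p" "p dvd b * x - a * y"
proof -
  define k where "k = nat \<lfloor>sqrt (real_of_int p)\<rfloor>"
  have p0: "p > 1" using assms by (rule prime_gt_1_int)
  have k: "int k ^ 2 < p" "p < (int k + 1)\<^sup>2"
  proof -
    have k': "real k = of_int \<lfloor>sqrt (real_of_int p)\<rfloor>"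
      using p0 by (simp add: k_def)
    have "real k ^ 2 \<le> (sqrt (real_of_int p))\<^sup>2"
      by (rule power_mono) (simp add: k', simp)
    then have "real k ^ 2 \<le> real_of_int p"
      using p0 by simp
    then have "int k ^ 2 \<le> p"
      by (metis of_int_le_iff of_int_of_nat_eq of_int_power)
    moreover have "int k ^ 2 \<noteq> p"
      using assms prime_power_iff[of "int k" 2] by auto
    ultimately show "int k ^ 2 < p" by simp
    have "(sqrt (real_of_int p))\<^sup>2 < (real k + 1)\<^sup>2"
      using p0 by (intro power_strict_mono) (simp_all add: k')
    then have "real_of_int p < (real k + 1)\<^sup>2"
      using p0 by simp
    then have "real_of_int p < real_of_int ((int k + 1)\<^sup>2)"
      by simp
    then show "p < (int k + 1)\<^sup>2"
      by (simp only: of_int_less_iff)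
  qed
  let ?S = "{0..int k} \<times> {0..int k}"
  let ?f = "\<lambda>(x, y). (b * x - a * y) mod p"
  have "?f ` ?S \<subseteq> {0..<p}"
    using p0 by auto
  then have "card (?f ` ?S) \<le> nat p"
    using card_mono[of "{0..<p}" "?f ` ?S"] by simp
  also have "nat p < card ?S"
  proof -
    have "card ?S = (k + 1) * (k + 1)"
      by (simp add: card_cartesian_product nat_add_distrib)
    moreover have "p < int ((k + 1) * (k + 1))"
      using k(2) by (simp add: power2_eq_square algebra_simps)
    ultimately show ?thesis
      using p0 by (simp add: nat_less_iff)
  qed
  finally obtain u v where uv: "u \<in> ?S" "v \<in> ?S" "u \<noteq> v" "?f u = ?f v"
    using pigeonhole[of ?f ?S] unfolding inj_on_def by blast
  obtain x y x' y' where xy: "u = (x, y)" "v = (x', y')"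
    by (metis surj_pair)
  have small: "(s - t)\<^sup>2 < p" if "s \<in> {0..int k}" "t \<in> {0..int k}" for s t
  proof -
    have "\<bar>s - t\<bar> \<le> \<bar>int k\<bar>" using that by auto
    then have "(s - t)\<^sup>2 \<le> (int k)\<^sup>2" by (simp only: abs_le_square_iff)
    then show ?thesis using k(1) by simp
  qed
  show ?thesis
  proof (rule that)
    show "x - x' \<noteq> 0 \<or> y - y' \<noteq> 0" using uv(3) xy by auto
    show "(x - x')\<^sup>2 < p" "(y - y')\<^sup>2 < p" using uv(1,2) xy small by auto
    have "p dvd (b * x - a * y) - (b * x' - a * y')"
      using uv(4) xy by (simp add: mod_eq_dvd_iff)
    then show "p dvd b * (x - x') - a * (y - y')"
      by (simp add: algebra_simps)
  qed
qed

text \<open>Thue's lemma gives \<pi> whose norm is a positive multiple of p below 3p. As even norms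
  are multiples of 4, 2p is excluded and the norm is p. Then p divides z times the conjugate of
  \<pi>, so \<pi> divides z.\<close>

lemma eis_prime_factor:
  fixes p :: int
  assumes p: "prime p" "odd p" and dvd: "p dvd enorm z" and ndvd: "\<not> p dvd om_part z"
  obtains \<pi> z' where "z = \<pi> * z'" "enorm \<pi> = p"
proof -
  define a b where "a = re_part z" and "b = om_part z"
  have N: "p dvd a\<^sup>2 - a * b + b\<^sup>2" and b: "\<not> p dvd b"
    using dvd ndvd by (simp_all add: enorm_def eisenstein_norm_def a_def b_def)
  obtain x y where xy: "x \<noteq> 0 \<or> y \<noteq> 0" "x\<^sup>2 < p" "y\<^sup>2 < p" "p dvd b * x - a * y"
    using thue[OF p(1)] by blast
  define \<pi> where "\<pi> = Eis x y"
  have pN: "enorm \<pi> = x\<^sup>2 - x * y + y\<^sup>2"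
    by (simp add: \<pi>_def enorm_def eisenstein_norm_def)
  have "b\<^sup>2 * (x\<^sup>2 - x * y + y\<^sup>2) = (b * x - a * y) * (b * x + a * y - b * y) + (a\<^sup>2 - a * b + b\<^sup>2) * y\<^sup>2"
    by (simp add: algebra_simps power2_eq_square)
  then have "p dvd b\<^sup>2 * (x\<^sup>2 - x * y + y\<^sup>2)"
    using N xy(4) by (metis dvd_add dvd_mult2)
  then have "p dvd enorm \<pi>"
    using p(1) b by (simp add: pN prime_dvd_mult_iff prime_dvd_power_iff)
  then obtain c where c: "enorm \<pi> = p * c" ..
  have p0: "p > 0" using p(1) by (rule prime_gt_0_int)
  have "4 * enorm \<pi> > 0"
    using xy(1) unfolding enorm_alt by (cases "y = 0") (auto simp: \<pi>_def add_pos_nonneg add_nonneg_pos)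
  then have "c > 0"
    using p0 c by (simp add: zero_less_mult_iff)
  have "x\<^sup>2 - x * y + y\<^sup>2 < 3 * p"
  proof -
    have "2 * (x\<^sup>2 - x * y + y\<^sup>2) = 3 * x\<^sup>2 + 3 * y\<^sup>2 - (x + y)\<^sup>2"
      by (simp add: algebra_simps power2_eq_square)
    moreover have "n < 3 * p" if "2 * n = 3 * u + 3 * v - w" "u < p" "v < p" "w \<ge> 0" for n u v w :: int
      using that by linarith
    ultimately show ?thesis
      using xy(2,3) zero_le_power2 by blast
  qed
  then have "c < 3"
    using c p0 pN by (metis mult.commute mult_less_cancel_left_pos)
  moreover have "c \<noteq> 2"
  proof
    assume "c = 2"
    then have "4 dvd p * 2"
      using enorm_even_imp_4_dvd[of \<pi>] c by simp
    then show False using p(2) by presburger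
  qed
  ultimately have "c = 1"
    using \<open>c > 0\<close> by linarith
  then have "enorm \<pi> = p"
    using c by simp
  \<comment> \<open>\<open>s\<close> and \<open>b * x - a * y\<close> are the coordinates of z times
    the conjugate of \<pi>.\<close>
  define s where "s = a * (x - y) + b * y"
  have "b * s = a * (b * x - a * y) + y * (a\<^sup>2 - a * b + b\<^sup>2)"
    by (simp add: s_def algebra_simps power2_eq_square)
  then have "p dvd b * s"
    using N xy(4) by (metis dvd_add dvd_mult)
  then have "p dvd s"
    using p(1) b by (simp add: prime_dvd_mult_iff)
  then obtain s' t' where st: "s = p * s'" "b * x - a * y = p * t'"
    using xy(4) by (auto elim!: dvdE)
  have "p * re_part (\<pi> * Eis s' t') = p * a" "p * om_part (\<pi> * Eis s' t') = p * b"
  proof -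
    have "p * re_part (\<pi> * Eis s' t') = x * s - y * (b * x - a * y)"
      by (simp add: st \<pi>_def algebra_simps)
    also have "\<dots> = (x\<^sup>2 - x * y + y\<^sup>2) * a"
      by (simp add: s_def algebra_simps power2_eq_square)
    finally show "p * re_part (\<pi> * Eis s' t') = p * a"
      using \<open>enorm \<pi> = p\<close> pN by simp
    have "p * om_part (\<pi> * Eis s' t') = x * (b * x - a * y) + y * s - y * (b * x - a * y)"
      by (simp add: st \<pi>_def algebra_simps)
    also have "\<dots> = (x\<^sup>2 - x * y + y\<^sup>2) * b"
      by (simp add: s_def algebra_simps power2_eq_square)
    finally show "p * om_part (\<pi> * Eis s' t') = p * b"
      using \<open>enorm \<pi> = p\<close> pN by simp
  qed
  then have "z = \<pi> * Eis s' t'"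
    using p0 by (simp only: eis_eq_iff a_def b_def mult_cancel_left) simp
  then show ?thesis
    using that \<open>enorm \<pi> = p\<close> by blast
qed

lemma near_unit_of_int:
  assumes "odd n" "\<not> 3 dvd (n::int)"
  shows "near_unit (of_int n)"
proof -
  have "6 dvd n - 1 \<or> 6 dvd n + 1"
    using assms by presburger
  then show ?thesis
    by (auto simp: near_unit_def eis_units_def numeral_dvd_eis_iff)
qed

text \<open>Induction on the norm, stripping near units. A prime p dividing z is 1 or -1 modulo 6
  and gets stripped. Otherwise a factor \<pi> of norm p splits off: it is stripped if it is a near
  unit, and makes p a Type 1 prime if not.\<close>

lemma type1_prime_dvd_enorm:
  assumes "odd (enorm z)" "\<not> 3 dvd enorm z" "\<not> near_unit z"
  shows "\<exists>p. type1_prime p \<and> p dvd enorm z"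
  using assms
proof (induction "nat (enorm z)" arbitrary: z rule: less_induct)
  case less
  note odd = less.prems(1) and n3 = less.prems(2) and nu = less.prems(3)
  have gt1: "enorm z > 1"
    using not_near_unit_enorm[OF odd n3 nu] eisenstein_norm_type1_gt_1 by metis
  have descend: ?case if z: "z = x * w" and x: "near_unit x" "enorm x > 1" for x w
  proof -
    have N: "enorm z = enorm x * enorm w"
      using z enorm_mult by simp
    then have "enorm w > 0"
      using gt1 enorm_nonneg[of w] by (cases "enorm w = 0") auto
    moreover from this have "1 * enorm w < enorm x * enorm w"
      using x(2) by (intro mult_strict_right_mono)
    then have "enorm w < enorm z"
      using N by simp
    moreover have "odd (enorm w)" "\<not> 3 dvd enorm w"
      using odd n3 N by auto
    moreover have "\<not> near_unit w"
      using nu z x near_unit_mult by blast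
    ultimately have "\<exists>p. type1_prime p \<and> p dvd enorm w"
      by (intro less.hyps) auto
    then show ?thesis using N by auto
  qed
  obtain p where p: "prime p" "p dvd enorm z"
    using gt1 prime_divisor_exists[of "enorm z"] by (auto simp: zdvd1_eq)
  have p2: "odd p" and p3: "\<not> 3 dvd p"
    using odd n3 p(2) dvd_trans by blast+
  have p1: "p > 1" using p(1) by (rule prime_gt_1_int)
  show ?case
  proof (cases "p dvd om_part z")
    case True
    have "p dvd (re_part z)\<^sup>2"
    proof -
      have "(re_part z)\<^sup>2 = enorm z + om_part z * (re_part z - om_part z)"
        by (simp add: enorm_def eisenstein_norm_def power2_eq_square algebra_simps)
      then show ?thesis using True p(2) by simp
    qed
    then obtain a b where "re_part z = p * a" "om_part z = p * b"
      using True p(1) by (auto simp: prime_dvd_power_iff elim!: dvdE)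
    then have "z = of_int p * Eis a b"
      by (simp add: eis_eq_iff)
    moreover have "enorm (of_int p) > 1"
      using p1 by (simp add: enorm_def eisenstein_norm_def one_less_power)
    ultimately show ?thesis
      using descend near_unit_of_int[OF p2 p3] by blast
  next
    case False
    obtain \<pi> z' where \<pi>: "z = \<pi> * z'" "enorm \<pi> = p"
      using eis_prime_factor[OF p(1) p2 p(2) False] .
    show ?thesis
    proof (cases "near_unit \<pi>")
      case True
      then show ?thesis using descend \<pi> p1 by blast
    next
      case False
      then have "type1_prime p"
        using not_near_unit_enorm[of \<pi>] p(1) p2 p3 \<pi>(2) unfolding type1_prime_def by metis
      then show ?thesis using p(2) by blast
    qed
  qed
qed

section \<open>Divisibility by 2 and 3\<close>

lemma three_dvd_cube_diff: "3 dvd n ^ 3 - (n::int)"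
proof -
  have "3 dvd n - 1 \<or> 3 dvd n \<or> 3 dvd n + 1"
    by presburger
  then have "3 dvd (n - 1) * n * (n + 1)"
    by (auto intro: dvd_mult dvd_mult2)
  then show ?thesis
    by (simp add: eval_nat_numeral algebra_simps)
qed

lemma enorm_val3:
  "enorm (val3 f) = (val1 f)\<^sup>2 - 3 * (tot f 0 * tot f 1 + tot f 1 * tot f 2 + tot f 2 * tot f 0)"
  by (simp add: val1_def val3_def enorm_def eisenstein_norm_def power2_eq_square algebra_simps)

text \<open>Modulo 1 - \<omega>, \<open>part\<close> agrees with \<open>tot\<close>, and cubing
  sharpens this to 3(1 - \<omega>). That precision matters: when 3 divides \<open>val1 f\<close>, a
  factor 1 - \<omega> is cancelled and a congruence modulo 3 must remain.\<close>

lemma val9_congruence: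
  obtains K where "val9 f = val3 f + of_int (val1 f * (enorm (val3 f) - 1)) + 3 * (1 - om) * K"
proof -
  \<comment> \<open>The quotient of \<open>part f i - tot f i\<close> by \<omega> - 1, since
    \<omega>^2 - 1 = (\<omega> - 1)(\<omega> + 1).\<close>
  define v where "v i = of_int (f (i + 3)) + of_int (f (i + 6)) * (om + 1)" for i
  define x y z where "x = tot f 0" and "y = tot f 1" and "z = tot f 2"
  define X Y Z :: eis where "X = of_int x" and "Y = of_int y" and "Z = of_int z"
  define l where "l = om - 1"
  have l2: "l * l = - 3 * om"
    by (simp add: l_def eis_eq_iff)
  have "part f i = of_int (tot f i) + l * v i" for i
    by (simp add: part_def tot_def v_def l_def algebra_simps power2_eq_square)
  then have parts: "part f 0 = X + l * v 0" "part f 1 = Y + l * v 1" "part f 2 = Z + l * v 2"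
    by (simp_all add: X_def Y_def Z_def x_def y_def z_def)
  have cube: "(r + l * s) ^ 3 = r ^ 3 + 3 * (- l) * (om * s ^ 3 - r * l * s\<^sup>2 - r\<^sup>2 * s)" for r s :: eis
  proof -
    have "(r + l * s) ^ 3 = r ^ 3 + 3 * r\<^sup>2 * l * s + 3 * r * l * l * s\<^sup>2 + (l * l) * l * s ^ 3"
      by (simp add: eval_nat_numeral algebra_simps)
    then show ?thesis
      unfolding l2 by (simp add: algebra_simps)
  qed
  obtain i j k where ijk: "x ^ 3 = x + 3 * i" "y ^ 3 = y + 3 * j" "z ^ 3 = z + 3 * k"
    using three_dvd_cube_diff[of x] three_dvd_cube_diff[of y] three_dvd_cube_diff[of z] by (auto elim!: dvdE simp: algebra_simps)
  then have XYZ: "X ^ 3 = X + 3 * of_int i" "Y ^ 3 = Y + 3 * of_int j" "Z ^ 3 = Z + 3 * of_int k"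
    unfolding X_def Y_def Z_def by (metis of_int_add of_int_mult of_int_numeral of_int_power)+
  have N: "val1 f * (enorm (val3 f) - 1) = 3 * (i + j + k - x * y * z)"
  proof -
    have "val1 f * (enorm (val3 f) - 1) = x ^ 3 + y ^ 3 + z ^ 3 - 3 * x * y * z - (x + y + z)"
      unfolding enorm_val3 val1_def x_def[symmetric] y_def[symmetric] z_def[symmetric]
      by (simp add: eval_nat_numeral algebra_simps)
    then show ?thesis
      unfolding ijk by simp
  qed
  define c where "c r s = om * s ^ 3 - r * l * s\<^sup>2 - r\<^sup>2 * s" for r s
  define W where "W = v 0 * part f 1 * part f 2 + X * v 1 * part f 2 + X * Y * v 2"
  have prod: "part f 0 * part f 1 * part f 2 = X * Y * Z + l * W"
    unfolding W_def parts by (simp add: algebra_simps)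
  have cubes: "part f 0 ^ 3 = X + 3 * of_int i + 3 * (1 - om) * c X (v 0)"
    "part f 1 ^ 3 = Y + 3 * of_int j + 3 * (1 - om) * c Y (v 1)"
    "part f 2 ^ 3 = Z + 3 * of_int k + 3 * (1 - om) * c Z (v 2)"
    unfolding parts cube c_def[symmetric] XYZ by (simp_all add: l_def)
  \<comment> \<open>In multiples of 3 the coefficients \<omega> and \<omega>^2 are replaced by 1;
    the differences are multiples of 3(1 - \<omega>) and enter the last bracket.\<close>
  have V: "val9 f = val3 f + 3 * (of_int i + of_int j + of_int k - X * Y * Z)
    + 3 * (1 - om) * (c X (v 0) + om * c Y (v 1) + om\<^sup>2 * c Z (v 2) - of_int j - (1 + om) * of_int k
       + X * Y * Z + om * W)"
    unfolding val9_def prod cubes val3_def x_def[symmetric] y_def[symmetric] z_def[symmetric]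
      X_def[symmetric] Y_def[symmetric] Z_def[symmetric]
    by (simp add: l_def algebra_simps power2_eq_square)
  have S: "3 * (of_int i + of_int j + of_int k - X * Y * Z) = (of_int (3 * (i + j + k - x * y * z)) :: eis)"
    by (simp add: X_def Y_def Z_def)
  show ?thesis
    by (rule that[OF V[unfolded S, folded N]])
qed

lemma enorm_cong_3:
  assumes "3 dvd x - y"
  shows "3 dvd enorm x \<longleftrightarrow> 3 dvd enorm y"
  using assms unfolding three_dvd_enorm_iff numeral_dvd_eis_iff eis_parts by presburger

lemma three_dvd_val3_iff: "3 dvd enorm (val3 f) \<longleftrightarrow> 3 dvd val1 f"
proof -
  have "re_part (val3 f) + om_part (val3 f) = val1 f + 3 * (- tot f 2)"
    by (simp add: val3_def val1_def power2_eq_square)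
  then show ?thesis
    unfolding three_dvd_enorm_iff by presburger
qed

lemma three_dvd_val9_diff_val3: "3 dvd val9 f - val3 f"
proof -
  obtain K where K: "val9 f = val3 f + of_int (val1 f * (enorm (val3 f) - 1)) + 3 * (1 - om) * K"
    by (rule val9_congruence)
  have "3 dvd val1 f * (enorm (val3 f) - 1)"
  proof -
    have "val1 f * (enorm (val3 f) - 1) = val1 f ^ 3 - val1 f
        - 3 * (val1 f * (tot f 0 * tot f 1 + tot f 1 * tot f 2 + tot f 2 * tot f 0))"
      unfolding enorm_val3 by (simp add: eval_nat_numeral algebra_simps)
    then show ?thesis
      using three_dvd_cube_diff[of "val1 f"] by simp
  qed
  then have "(3::eis) dvd of_int (val1 f * (enorm (val3 f) - 1))"
    by (simp add: numeral_dvd_eis_iff)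
  then show ?thesis
    unfolding K by (simp add: add.assoc mult.assoc)
qed

lemma three_dvd_val9_iff: "3 dvd enorm (val9 f) \<longleftrightarrow> 3 dvd val1 f"
  using enorm_cong_3[OF three_dvd_val9_diff_val3] three_dvd_val3_iff by simp

lemma three_dvd_det9_iff: "3 dvd det9 f \<longleftrightarrow> 3 dvd val1 f"
  using three_dvd_val3_iff three_dvd_val9_iff by (auto simp: det9_def prime_dvd_mult_iff)

section \<open>Congruences at the prime 2\<close>

lemma two_dvd_eis_mult_iff: "(2::eis) dvd x * y \<longleftrightarrow> 2 dvd x \<or> 2 dvd y"
  unfolding even_enorm_iff[symmetric] enorm_mult by simp

lemma eis_cube_mod_2:
  fixes x :: eis
  assumes "\<not> 2 dvd x"
  shows "2 dvd x ^ 3 - 1"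
  using assms by (auto simp: numeral_dvd_eis_iff power3_eq_cube)

text \<open>2 is inert in the 9th cyclotomic field, so it divides \<open>A, B, C\<close> as soon as it divides the norm.\<close>

lemma two_dvd_val9:
  assumes "2 dvd val9 f"
  shows "8 dvd val9 f"
proof -
  define A B C where "A = part f 0" and "B = part f 1" and "C = part f 2"
  have V: "val9 f = A ^ 3 + om * B ^ 3 + om\<^sup>2 * C ^ 3 - 3 * om * (A * B * C)"
    by (simp add: val9_def A_def B_def C_def)
  \<comment> \<open>The value of x^3 modulo 2, as the nonzero elements of the field of four elements
    have cube 1.\<close>
  define e where "e x = (if 2 dvd x then 0 else 1 :: eis)" for x :: eis
  have e: "\<exists>y. x ^ 3 = e x + 2 * y" for x
  proof -
    have "2 dvd x ^ 3 - e x"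
      using eis_cube_mod_2[of x] by (simp add: e_def power3_eq_cube)
    then show ?thesis
      by (metis add.commute diff_add_cancel dvd_def)
  qed
  obtain a b c where abc: "A ^ 3 = e A + 2 * a" "B ^ 3 = e B + 2 * b" "C ^ 3 = e C + 2 * c"
    using e by metis
  have red: "2 dvd e A + om * e B + om\<^sup>2 * e C - om * (A * B * C)"
  proof -
    have eq: "e A + om * e B + om\<^sup>2 * e C - om * (A * B * C)
        = val9 f + 2 * (om * (A * B * C) - a - om * b - om\<^sup>2 * c)"
      unfolding V abc by (simp add: algebra_simps)
    show ?thesis
      unfolding eq using assms by simp
  qed
  have "2 dvd A \<and> 2 dvd B \<and> 2 dvd C"
  \<comment> \<open>If 2 divides ABC, some \<open>e\<close> value is 0, and 1, \<omega>, \<omega>^2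
    have no vanishing proper nonempty subsum modulo 2, so all are 0. Otherwise 1 + \<omega> +
    \<omega>^2 = 0 leaves only the term in ABC, which then would be even.\<close>
  proof (cases "2 dvd A * B * C")
    case True
    then have "2 dvd e A + om * e B + om\<^sup>2 * e C"
      using red by (metis diff_add_cancel dvd_add dvd_mult)
    then show ?thesis
      using True unfolding two_dvd_eis_mult_iff
      by (auto simp: e_def numeral_dvd_eis_iff power2_eq_square split: if_splits)
  next
    case False
    then have "e A = 1" "e B = 1" "e C = 1"
      unfolding two_dvd_eis_mult_iff by (auto simp: e_def)
    moreover have "1 + om * 1 + om\<^sup>2 * 1 = 0"
      by (simp add: om_square)
    ultimately have "2 dvd om * (A * B * C)"
      using red by (simp only: diff_0 dvd_minus_iff)
    moreover have "\<not> 2 dvd om"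
      by (simp add: numeral_dvd_eis_iff)
    ultimately show ?thesis
      using False two_dvd_eis_mult_iff by blast
  qed
  then obtain a' b' c' where "A = 2 * a'" "B = 2 * b'" "C = 2 * c'"
    by (auto elim!: dvdE)
  then have "val9 f = 8 * (a' ^ 3 + om * b' ^ 3 + om\<^sup>2 * c' ^ 3 - 3 * om * (a' * b' * c'))"
    unfolding V by (simp add: power_mult_distrib algebra_simps)
  then show ?thesis
    by (rule dvdI)
qed

lemma val_cong_2:
  assumes "\<And>k. k < 9 \<Longrightarrow> even (f k - g k)"
  shows "2 dvd val1 f - val1 g" "2 dvd val3 f - val3 g" "2 dvd val9 f - val9 g"
proof -
  obtain h where h: "f k = g k + 2 * h k" if "k < 9" for k
  proof -
    have "\<forall>k. \<exists>c. k < 9 \<longrightarrow> f k = g k + 2 * c"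
      using assms by (metis add.commute diff_add_cancel dvd_def)
    then show ?thesis using that by metis
  qed
  have t: "tot f i = tot g i + 2 * tot h i" "part f i = part g i + 2 * part h i" if "i < 3" for i
    using that by (simp_all add: tot_def part_def h algebra_simps)
  show "2 dvd val1 f - val1 g"
    by (simp add: val1_def t)
  have "val3 f - val3 g = 2 * val3 h"
    by (simp add: val3_def t algebra_simps)
  then show "2 dvd val3 f - val3 g"
    by simp
  have mult: "2 dvd x * y - x' * y'" if "2 dvd x - x'" "2 dvd y - y'" for x y x' y' :: eis
  proof -
    have "x * y - x' * y' = (x - x') * y + x' * (y - y')"
      by (simp add: algebra_simps)
    then show ?thesis
      using that by simp
  qed
  have p: "2 dvd part f i - part g i" if "i < 3" for i
    by (simp add: t that)
  have "val9 f - val9 g = (part f 0 ^ 3 - part g 0 ^ 3) + om * (part f 1 ^ 3 - part g 1 ^ 3)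
      + om\<^sup>2 * (part f 2 ^ 3 - part g 2 ^ 3)
      - 3 * om * (part f 0 * part f 1 * part f 2 - part g 0 * part g 1 * part g 2)"
    by (simp add: val9_def algebra_simps)
  moreover have "2 dvd part f i ^ 3 - part g i ^ 3" if "i < 3" for i
    unfolding power3_eq_cube using p[OF that] by (intro mult)
  moreover have "2 dvd part f 0 * part f 1 * part f 2 - part g 0 * part g 1 * part g 2"
    using p by (intro mult) auto
  ultimately show "2 dvd val9 f - val9 g"
    by (simp only: dvd_add dvd_diff dvd_mult zero_less_numeral one_less_numeral_iff semiring_norm)
qed

text \<open>Split by parity: an even \<beta> yields 64 through \<open>two_dvd_val9\<close>; an even
  \<alpha> makes \<gamma> even too and yields 16; if all four are odd, one is not a near unit and
  supplies a Type 1 prime.\<close>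

lemma det9_pair_structure:
  assumes fg: "\<And>k. k < 9 \<Longrightarrow> even (f k - g k)"
    and f3: "3 dvd val1 f" and D81: "\<not> 81 dvd det9 f * det9 g"
  obtains q where "det9 f * det9 g = 27 * q" "\<not> 3 dvd q"
    "(\<exists>p. type1_prime p \<and> p dvd q \<and> (odd q \<or> 4 dvd q)) \<or> (16 dvd q \<and> (even (q div 16) \<longrightarrow> 64 dvd q))"
proof -
  obtain t where t: "val1 f = 3 * t"
    using f3 ..
  obtain \<alpha> where \<alpha>: "val3 f = (1 - om) * \<alpha>" "enorm (val3 f) = 3 * enorm \<alpha>"
    using three_dvd_enormE f3 three_dvd_val3_iff by metis
  obtain \<beta> where \<beta>: "val9 f = (1 - om) * \<beta>" "enorm (val9 f) = 3 * enorm \<beta>"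
    using three_dvd_enormE f3 three_dvd_val9_iff by metis
  define \<gamma> \<delta> where "\<gamma> = val3 g" and "\<delta> = val9 g"
  define q where "q = t * enorm \<alpha> * enorm \<beta> * (val1 g * enorm \<gamma> * enorm \<delta>)"
  have D: "det9 f * det9 g = 27 * q"
    by (simp add: det9_def q_def t \<alpha>(2) \<beta>(2) \<gamma>_def \<delta>_def)
  then have q3: "\<not> 3 dvd q"
    using D81 by presburger
  then have n3: "\<not> 3 dvd t" "\<not> 3 dvd enorm \<alpha>" "\<not> 3 dvd enorm \<beta>" "\<not> 3 dvd enorm \<gamma>" "\<not> 3 dvd enorm \<delta>"
    by (auto simp: q_def)
  have c1: "even t \<longleftrightarrow> even (val1 g)"
    using val_cong_2(1)[of f g, OF fg] by (simp add: t)
  have c2: "2 dvd (1 - om) * \<alpha> - \<gamma>" "2 dvd (1 - om) * \<beta> - \<delta>"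
    using val_cong_2(2,3)[of f g, OF fg] by (simp_all add: \<alpha>(1) \<beta>(1) \<gamma>_def \<delta>_def)
  have transfer: "even (enorm y)" if "2 dvd (1 - om) * x - y" "even (enorm x)" for x y
    using that unfolding even_enorm_iff by (metis diff_add_cancel dvd_add_right_iff dvd_mult)
  have "(\<exists>p. type1_prime p \<and> p dvd q \<and> (odd q \<or> 4 dvd q)) \<or> (16 dvd q \<and> (even (q div 16) \<longrightarrow> 64 dvd q))"
  proof (cases "even (enorm \<beta>)")
    case True
    then have "2 dvd val9 f" "2 dvd val9 g"
      using transfer[OF c2(2) True] unfolding \<beta>(1) \<delta>_def even_enorm_iff by simp_all
    then have "8 dvd val9 f" 
      by (simp add: two_dvd_val9)
    then obtain w where "val9 f = 8 * w" ..
    then have "3 * enorm \<beta> = 64 * enorm w"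
      unfolding \<beta>(2)[symmetric] by (simp add: enorm_mult enorm_numeral)
    then have "64 dvd enorm \<beta>"
      by presburger
    then have "64 dvd q"
      by (simp add: q_def)
    moreover from this have "16 dvd q"
      by presburger
    ultimately show ?thesis by blast
  next
    case \<beta>_odd: False
    have \<delta>_odd: "odd (enorm \<delta>)"
    proof
      assume "even (enorm \<delta>)"
      then have "2 dvd (1 - om) * \<beta>"
        using c2(2) unfolding even_enorm_iff by (metis diff_add_cancel dvd_add)
      then show False
        using \<beta>_odd unfolding even_enorm_iff two_dvd_eis_mult_iff by (simp add: numeral_dvd_eis_iff)
    qed
    show ?thesis
    proof (cases "even (enorm \<alpha>)")
      case True
      then obtain a where a: "enorm \<alpha> = 4 * enorm a"
        unfolding even_enorm_iff by (auto elim!: dvdE simp: enorm_mult enorm_numeral)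
      obtain c where c: "enorm \<gamma> = 4 * enorm c"
        using transfer[OF c2(1) True] unfolding even_enorm_iff
        by (auto elim!: dvdE simp: enorm_mult enorm_numeral)
      define r where "r = t * val1 g * enorm a * enorm c * (enorm \<beta> * enorm \<delta>)"
      have q: "q = 16 * r"
        by (simp add: q_def a c r_def)
      \<comment> \<open>Factors 2 come in pairs: \<open>t\<close> and \<open>val1 g\<close> have the
        same parity, and even norms are multiples of 4.\<close>
      have "4 dvd r" if r: "even r"
      proof -
        consider "even t" | "even (enorm a)" | "even (enorm c)"
          using r \<beta>_odd \<delta>_odd by (auto simp: r_def c1)
        then show ?thesis
        proof cases
          case 1
          then have "2 * 2 dvd t * val1 g"
            using c1 by (intro mult_dvd_mono) auto
          then show ?thesis by (simp add: r_def)
        qed (auto simp: r_def dest: enorm_even_imp_4_dvd)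
      qed
      then have "64 dvd q" if "even r"
        using that unfolding q by presburger
      then show ?thesis
        using q by auto
    next
      case \<alpha>_odd: False
      have \<gamma>_odd: "odd (enorm \<gamma>)"
      proof
        assume "even (enorm \<gamma>)"
        then have "2 dvd (1 - om) * \<alpha>"
          using c2(1) unfolding even_enorm_iff by (metis diff_add_cancel dvd_add)
        then show False
          using \<alpha>_odd unfolding even_enorm_iff two_dvd_eis_mult_iff by (simp add: numeral_dvd_eis_iff)
      qed
      have "\<not> (near_unit \<alpha> \<and> near_unit \<beta> \<and> near_unit \<gamma> \<and> near_unit \<delta>)"
      proof
        assume nu: "near_unit \<alpha> \<and> near_unit \<beta> \<and> near_unit \<gamma> \<and> near_unit \<delta>"
        obtain K where K: "val9 f = val3 f + of_int (val1 f * (enorm (val3 f) - 1)) + 3 * (1 - om) * K"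
          by (rule val9_congruence)
        \<comment> \<open>The congruence of \<open>val9_congruence\<close> is divided by 1 -
          \<omega>. Since \<open>3 * enorm \<alpha> - 1\<close> is -1 modulo 3, the correction
          becomes -t(2 + \<omega>).\<close>
        have three: "(3::eis) = (1 - om) * (2 + om)"
          by (simp add: eis_eq_iff)
        have "of_int (val1 f * (enorm (val3 f) - 1)) = (3::eis) * of_int (t * (3 * enorm \<alpha> - 1))"
          by (simp add: t \<alpha>(2))
        also have "\<dots> = (1 - om) * ((2 + om) * of_int (t * (3 * enorm \<alpha> - 1)))"
          unfolding three[THEN arg_cong, of "\<lambda>c. c * of_int (t * (3 * enorm \<alpha> - 1))"] by (rule mult.assoc)
        finally have V: "of_int (val1 f * (enorm (val3 f) - 1))
            = (1 - om) * ((2 + om) * of_int (t * (3 * enorm \<alpha> - 1)))" .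
        have "(1 - om) * \<beta> = (1 - om) * \<alpha> + (1 - om) * ((2 + om) * of_int (t * (3 * enorm \<alpha> - 1))) + 3 * (1 - om) * K"
          using K unfolding V unfolding \<alpha>(1) \<beta>(1) .
        also have "\<dots> = (1 - om) * (\<alpha> + (2 + om) * of_int (t * (3 * enorm \<alpha> - 1)) + 3 * K)"
          by (simp add: algebra_simps)
        finally have "(1 - om) * \<beta> = (1 - om) * (\<alpha> + (2 + om) * of_int (t * (3 * enorm \<alpha> - 1)) + 3 * K)" .
        then have \<beta>_eq: "\<beta> = \<alpha> + (2 + om) * of_int (t * (3 * enorm \<alpha> - 1)) + 3 * K"
          by (rule one_minus_om_cancel)
        have "\<beta> - \<alpha> + of_int t * (2 + om) = 3 * (K + (2 + om) * of_int (t * enorm \<alpha>))"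
          unfolding \<beta>_eq by (simp add: algebra_simps)
        then have "3 dvd \<beta> - \<alpha> + of_int t * (2 + om)"
          by simp
        then show False
          using not_all_near_unit[OF _ _ _ _ c2] nu three_dvd_val9_diff_val3[of g] n3(1)
          unfolding \<gamma>_def \<delta>_def by blast
      qed
      then obtain z where z: "z \<in> {\<alpha>, \<beta>, \<gamma>, \<delta>}" "\<not> near_unit z"
        by blast
      then obtain p where "type1_prime p" "p dvd enorm z"
        using type1_prime_dvd_enorm[of z] \<alpha>_odd \<beta>_odd \<gamma>_odd \<delta>_odd n3 by blast
      moreover have "enorm z dvd q"
        using z(1) by (auto simp: q_def)
      moreover have "odd q \<or> 4 dvd q"
      proof (cases "even t")
        case True
        then have "2 * 2 dvd t * val1 g"
          using c1 by (intro mult_dvd_mono) auto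
        moreover have "q = t * val1 g * (enorm \<alpha> * enorm \<beta> * enorm \<gamma> * enorm \<delta>)"
          by (simp add: q_def)
        ultimately show ?thesis by simp
      next
        case False
        then show ?thesis
          using c1 \<alpha>_odd \<beta>_odd \<gamma>_odd \<delta>_odd by (simp add: q_def)
      qed
      ultimately show ?thesis
        using dvd_trans by blast
    qed
  qed
  then show ?thesis
    using that D q3 by blast
qed

lemma type1_prime_coprime_6:
  assumes "type1_prime p"
  shows "odd p" "\<not> 3 dvd p"
proof -
  obtain A B where p: "p = eisenstein_norm (2 * (1 + 3 * B)) (3 * (1 + 2 * A))"
    using assms by (auto simp: type1_prime_def)
  show "odd p"
    by (simp add: p eisenstein_norm_def)
  have "\<not> 3 dvd 2 * (1 + 3 * B) + 3 * (1 + 2 * A)"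
    by presburger
  then show "\<not> 3 dvd p"
    using three_dvd_enorm_iff[of "Eis (2 * (1 + 3 * B)) (3 * (1 + 2 * A))"] by (simp add: enorm_def p)
qed

lemma integer_group_det_18_cases:
  assumes "D \<in> integer_group_dets TYPE(18)" "27 dvd D" "\<not> 81 dvd D"
  obtains q where "D = 27 * q" "\<not> 3 dvd q"
    "(\<exists>p. type1_prime p \<and> p dvd q \<and> (odd q \<or> 4 dvd q)) \<or> (16 dvd q \<and> (even (q div 16) \<longrightarrow> 64 dvd q))"
proof -
  obtain f g where D: "D = det9 f * det9 g" and fg: "\<forall>k<9. even (f k - g k)"
    using assms(1) by (auto simp: integer_group_dets_18)
  have "3 dvd det9 f * det9 g"
    using assms(2) D dvd_trans[of 3 27 D] by simp
  then consider "3 dvd val1 f" | "3 dvd val1 g"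
    using prime_dvd_mult_iff[of "3::int"] by (auto simp: three_dvd_det9_iff)
  then show ?thesis
  proof cases
    case 1
    show ?thesis
    proof (rule det9_pair_structure[of f g])
      show "even (f k - g k)" if "k < 9" for k
        using fg that by blast
    qed (use 1 assms(3) that D in blast)+
  next
    case 2
    have D': "D = det9 g * det9 f"
      using D by (rule trans) (rule mult.commute)
    show ?thesis
    proof (rule det9_pair_structure[of g f])
      show "even (g k - f k)" if "k < 9" for k
        using fg that by (metis dvd_diff_commute)
    qed (use 2 assms(3) that D' in blast)+
  qed
qed

lemma det9_uminus: "det9 (\<lambda>k. - f k) = - det9 f"
proof -
  have "tot (\<lambda>k. - f k) i = - tot f i" "part (\<lambda>k. - f k) i = - part f i" for i
    by (simp_all add: tot_def part_def)
  then have "val1 (\<lambda>k. - f k) = - val1 f" "val3 (\<lambda>k. - f k) = - val3 f" "val9 (\<lambda>k. - f k) = - val9 f"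
    by (simp_all add: val1_def val3_def val9_def algebra_simps)
  moreover have "enorm (- z) = enorm z" for z
    by (simp add: enorm_def eisenstein_norm_def)
  ultimately show ?thesis
    by (simp add: det9_def)
qed

text \<open>Thanks to this symmetry the constructions need only the multipliers 6h - 1 or 3h -
  1.\<close>

lemma integer_group_dets_18_uminus:
  assumes "D \<in> integer_group_dets TYPE(18)"
  shows "- D \<in> integer_group_dets TYPE(18)"
proof -
  obtain f g where D: "D = det9 f * det9 g" and fg: "\<forall>k<9. even (f k - g k)"
    using assms by (auto simp: integer_group_dets_18)
  have "- D = det9 (\<lambda>k. - f k) * det9 g"
    by (simp add: D det9_uminus)
  moreover have "\<forall>k<9. even (- f k - g k)"
    using fg by auto
  ultimately show ?thesis
    unfolding integer_group_dets_18 by blast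
qed

lemma integer_group_dets_18I:
  assumes "\<forall>k<9. even (f k - g k)" "D = det9 f * det9 g"
  shows "D \<in> integer_group_dets TYPE(18)"
  using assms unfolding integer_group_dets_18 by blast

section \<open>Constructions\<close>

text \<open>
  The shift \<open>(c, d, e)\<close> is chosen so that \<open>val3 f\<close> becomes, up to units and conjugation,
  \<open>1 - \<omega>\<close> times the element defining the Type 1 prime, while \<open>val1 f\<close> stays free.
  The base vectors were found by computer search.
\<close>

lemma type1_odd_dets:
  "27 * (6 * h - 1) * eisenstein_norm (2 * (1 + 3 * B)) (3 * (1 + 2 * A)) \<in> integer_group_dets TYPE(18)"
proof -
  \<comment> \<open>As c + d + e = 3h, \<open>h\<close> moves only \<open>val1 f\<close>, while
    \<open>A\<close> and \<open>B\<close> move only \<open>val3 f\<close>.\<close>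
  define c d e where "c = A + h" and "d = h - B" and "e = h + B - A"
  define f where "f = (!) [2 * c, 2 * d - 2, 2 * e - 2, 2 * c, 2 * d - 1, 2 * e, 2 * c + 2, 2 * d, 2 * e]"
  define g :: "nat \<Rightarrow> int" where "g = (!) [0, 0, 0, 0, 1, 0, 0, 0, 0]"
  have "val1 f = 3 * (6 * h - 1)"
    by (simp add: val1_def tot_def f_def c_def d_def e_def)
  moreover have "enorm (val3 f) = 3 * eisenstein_norm (2 * (1 + 3 * B)) (3 * (1 + 2 * A))"
    by (simp add: val3_def tot_def f_def c_def d_def e_def enorm_def eisenstein_norm_def
        power2_eq_square algebra_simps)
  moreover have "enorm (val9 f) = 3"
    by (simp add: val9_def part_def f_def enorm_def eisenstein_norm_def eval_nat_numeral)
  ultimately have "det9 f = 27 * (6 * h - 1) * eisenstein_norm (2 * (1 + 3 * B)) (3 * (1 + 2 * A))"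
    by (simp add: det9_def)
  moreover have "det9 g = 1"
    by (simp add: det9_def val1_def val3_def val9_def tot_def part_def g_def enorm_def
        eisenstein_norm_def eval_nat_numeral)
  moreover have "\<forall>k<9. even (f k - g k)"
    by (simp add: f_def g_def All_less_Suc eval_nat_numeral)
  ultimately show ?thesis
    by (intro integer_group_dets_18I[of f g]) simp_all
qed

text \<open>The factor 4 arises from \<open>val1 f\<close> and \<open>val1 g\<close>, both
  even.\<close>

lemma type1_even_dets:
  "108 * (3 * h - 1) * eisenstein_norm (2 * (1 + 3 * B)) (3 * (1 + 2 * A)) \<in> integer_group_dets TYPE(18)"
proof -
  define c d e where "c = h - A" and "d = h + A - B" and "e = h + B"
  define f where "f = (!) [2 * c - 2, 2 * d - 1, 2 * e, 2 * c - 2, 2 * d, 2 * e, 2 * c - 1, 2 * d, 2 * e]"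
  define g :: "nat \<Rightarrow> int" where "g = (!) [0, 1, 0, 0, 0, 0, 1, 0, 0]"
  have "val1 f = 6 * (3 * h - 1)"
    by (simp add: val1_def tot_def f_def c_def d_def e_def)
  moreover have "enorm (val3 f) = 3 * eisenstein_norm (2 * (1 + 3 * B)) (3 * (1 + 2 * A))"
    by (simp add: val3_def tot_def f_def c_def d_def e_def enorm_def eisenstein_norm_def
        power2_eq_square algebra_simps)
  moreover have "enorm (val9 f) = 3"
    by (simp add: val9_def part_def f_def enorm_def eisenstein_norm_def eval_nat_numeral)
  ultimately have "det9 f = 54 * (3 * h - 1) * eisenstein_norm (2 * (1 + 3 * B)) (3 * (1 + 2 * A))"
    by (simp add: det9_def)
  moreover have "det9 g = 2"
    by (simp add: det9_def val1_def val3_def val9_def tot_def part_def g_def enorm_def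
        eisenstein_norm_def eval_nat_numeral)
  moreover have "\<forall>k<9. even (f k - g k)"
    by (simp add: f_def g_def All_less_Suc eval_nat_numeral)
  ultimately show ?thesis
    by (intro integer_group_dets_18I[of f g]) simp_all
qed

text \<open>The factor 16 comes from even \<open>val3 f\<close> and \<open>val3 g\<close>, of norms
  12 and 4, with \<open>val1 f\<close> odd.\<close>

lemma sixteen_dets: "432 * (6 * h - 1) \<in> integer_group_dets TYPE(18)"
proof -
  define f where "f = (!) [2 * h - 2, 2 * h, 2 * h, 2 * h - 1, 2 * h, 2 * h, 2 * h, 2 * h + 1, 2 * h - 1]"
  define g :: "nat \<Rightarrow> int" where "g = (!) [0, 0, 0, -1, 0, 0, 0, 1, 1]"
  have "val1 f = 3 * (6 * h - 1)"
    by (simp add: val1_def tot_def f_def)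
  moreover have "enorm (val3 f) = 12"
    by (simp add: val3_def tot_def f_def enorm_def eisenstein_norm_def power2_eq_square)
  moreover have "enorm (val9 f) = 3"
    by (simp add: val9_def part_def f_def enorm_def eisenstein_norm_def eval_nat_numeral)
  ultimately have "det9 f = 108 * (6 * h - 1)"
    by (simp add: det9_def)
  moreover have "det9 g = 4"
    by (simp add: det9_def val1_def val3_def val9_def tot_def part_def g_def enorm_def
        eisenstein_norm_def eval_nat_numeral)
  moreover have "\<forall>k<9. even (f k - g k)"
    by (simp add: f_def g_def All_less_Suc eval_nat_numeral)
  ultimately show ?thesis
    by (intro integer_group_dets_18I[of f g]) simp_all
qed

text \<open>Both \<open>val1\<close> and \<open>val3\<close> are even, so \<open>f\<close> and
  \<open>g\<close> each contribute 2 * 4.\<close>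

lemma sixty_four_dets: "1728 * (3 * h - 1) \<in> integer_group_dets TYPE(18)"
proof -
  define f where "f = (!) [2 * h - 2, 2 * h - 1, 2 * h - 2, 2 * h - 2, 2 * h, 2 * h, 2 * h, 2 * h + 1, 2 * h]"
  define g :: "nat \<Rightarrow> int" where "g = (!) [0, 1, 0, 0, 0, 0, 0, 1, 0]"
  have "val1 f = 6 * (3 * h - 1)"
    by (simp add: val1_def tot_def f_def)
  moreover have "enorm (val3 f) = 12"
    by (simp add: val3_def tot_def f_def enorm_def eisenstein_norm_def power2_eq_square)
  moreover have "enorm (val9 f) = 3"
    by (simp add: val9_def part_def f_def enorm_def eisenstein_norm_def eval_nat_numeral)
  ultimately have "det9 f = 216 * (3 * h - 1)"
    by (simp add: det9_def)
  moreover have "det9 g = 8"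
    by (simp add: det9_def val1_def val3_def val9_def tot_def part_def g_def enorm_def
        eisenstein_norm_def eval_nat_numeral)
  moreover have "\<forall>k<9. even (f k - g k)"
    by (simp add: f_def g_def All_less_Suc eval_nat_numeral)
  ultimately show ?thesis
    by (intro integer_group_dets_18I[of f g]) simp_all
qed

section \<open>From explicit families to all multiples, and the final classification\<close>

lemma gcd_3_eq_1_iff: "gcd m 3 = 1 \<longleftrightarrow> \<not> 3 dvd (m::int)"
  using prime_imp_coprime[of "3::int" m] by (auto simp: coprime_iff_gcd_eq_1 gcd.commute)

lemma gcd_6_eq_1_iff: "gcd m 6 = 1 \<longleftrightarrow> odd m \<and> \<not> 3 dvd (m::int)"
proof -
  have "gcd m 6 = 1 \<longleftrightarrow> coprime m (2 * 3)"
    by (simp add: coprime_iff_gcd_eq_1)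
  also have "\<dots> \<longleftrightarrow> odd m \<and> \<not> 3 dvd m"
    unfolding coprime_mult_right_iff coprime_right_2_iff_odd
    by (simp only: coprime_iff_gcd_eq_1 gcd_3_eq_1_iff)
  finally show ?thesis .
qed

lemma det_multiples_mod_6:
  assumes "\<And>h. c * (6 * h - 1) \<in> integer_group_dets TYPE(18)" "odd m" "\<not> 3 dvd m"
  shows "c * m \<in> integer_group_dets TYPE(18)"
proof -
  have "\<exists>h. m = 6 * h - 1 \<or> m = - (6 * h - 1)"
    using assms(2,3) by presburger
  then obtain h where "m = 6 * h - 1 \<or> m = - (6 * h - 1)" ..
  then show ?thesis
    using assms(1)[of h] integer_group_dets_18_uminus[of "c * (6 * h - 1)"]
    by (metis mult_minus_right)
qed

lemma det_multiples_mod_3: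
  assumes "\<And>h. c * (3 * h - 1) \<in> integer_group_dets TYPE(18)" "\<not> 3 dvd m"
  shows "c * m \<in> integer_group_dets TYPE(18)"
proof -
  have "\<exists>h. m = 3 * h - 1 \<or> m = - (3 * h - 1)"
    using assms(2) by presburger
  then obtain h where "m = 3 * h - 1 \<or> m = - (3 * h - 1)" ..
  then show ?thesis
    using assms(1)[of h] integer_group_dets_18_uminus[of "c * (3 * h - 1)"]
    by (metis mult_minus_right)
qed

theorem theorem4:
  "{D \<in> integer_group_dets TYPE(18). odd D \<and> 3 ^ 3 dvd D \<and> \<not> 3 ^ 4 dvd D} =
     {3 ^ 3 * m * p | m p. type1_prime p \<and> gcd m 6 = 1}
   \<and>
   {D \<in> integer_group_dets TYPE(18). even D \<and> 3 ^ 3 dvd D \<and> \<not> 3 ^ 4 dvd D} =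
     {2 ^ 2 * 3 ^ 3 * m * p | m p. type1_prime p \<and> gcd m 3 = 1} \<union>
     {2 ^ 4 * 3 ^ 3 * m | m. gcd m 6 = 1} \<union>
     {2 ^ 6 * 3 ^ 3 * m | m. gcd m 3 = 1}"
  (is "?O = ?O' \<and> ?E = ?E1 \<union> ?E2 \<union> ?E3")
proof (intro conjI equalityI subsetI)
  fix D assume D: "D \<in> ?O"
  then have "D \<in> integer_group_dets TYPE(18)" "27 dvd D" "\<not> 81 dvd D"
    by simp_all
  then obtain q where q: "D = 27 * q" "\<not> 3 dvd q"
    "(\<exists>p. type1_prime p \<and> p dvd q \<and> (odd q \<or> 4 dvd q)) \<or> (16 dvd q \<and> (even (q div 16) \<longrightarrow> 64 dvd q))"
    by (rule integer_group_det_18_cases)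
  have "odd q" using D q(1) by auto
  moreover from this have "\<not> 16 dvd q" by presburger
  ultimately obtain p m where "type1_prime p" "q = p * m"
    using q(3) by (auto elim!: dvdE)
  moreover from this have "gcd m 6 = 1"
    using q(2) \<open>odd q\<close> by (auto simp: gcd_6_eq_1_iff)
  moreover from calculation have "D = 3 ^ 3 * m * p"
    by (simp add: q(1))
  ultimately show "D \<in> ?O'"
    by (intro CollectI exI[of _ m] exI[of _ p] conjI)
next
  fix D assume "D \<in> ?O'"
  then obtain m p where "D = 3 ^ 3 * m * p" and p: "type1_prime p" and "gcd m 6 = 1"
    unfolding mem_Collect_eq by metis
  then have D: "D = 27 * m * p" and m: "odd m" "\<not> 3 dvd m"
    unfolding gcd_6_eq_1_iff by simp_all
  obtain A B where AB: "p = eisenstein_norm (2 * (1 + 3 * B)) (3 * (1 + 2 * A))"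
    using p unfolding type1_prime_def by blast
  have "27 * p * (6 * h - 1) \<in> integer_group_dets TYPE(18)" for h
    using type1_odd_dets[of h B A] unfolding AB[symmetric] by (simp only: mult_ac)
  from det_multiples_mod_6[OF this m] have "D \<in> integer_group_dets TYPE(18)"
    by (simp only: D mult_ac)
  moreover have "\<not> 3 dvd m * p"
    using m type1_prime_coprime_6[OF p] by (simp add: prime_dvd_mult_iff)
  then have "\<not> 81 dvd 27 * (m * p)"
    by presburger
  ultimately show "D \<in> ?O"
    using m type1_prime_coprime_6[OF p] by (simp add: D mult.assoc)
next
  fix D assume D: "D \<in> ?E"
  then have "D \<in> integer_group_dets TYPE(18)" "27 dvd D" "\<not> 81 dvd D"
    by simp_all
  then obtain q where q: "D = 27 * q" "\<not> 3 dvd q"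
    "(\<exists>p. type1_prime p \<and> p dvd q \<and> (odd q \<or> 4 dvd q)) \<or> (16 dvd q \<and> (even (q div 16) \<longrightarrow> 64 dvd q))"
    by (rule integer_group_det_18_cases)
  have "even q" using D q(1) by auto
  then consider p where "type1_prime p" "p dvd q" "4 dvd q" | "16 dvd q" "odd (q div 16)" | "64 dvd q"
    using q(3) by blast
  then show "D \<in> ?E1 \<union> ?E2 \<union> ?E3"
  proof cases
    case 1
    have "coprime p (2 * 2)"
      unfolding coprime_mult_right_iff coprime_right_2_iff_odd using type1_prime_coprime_6[OF 1(1)] by simp
    then have "4 * p dvd q"
      using 1(2,3) by (intro divides_mult) (simp_all add: coprime_commute)
    then obtain m where m: "q = 4 * p * m" ..
    then have "gcd m 3 = 1"
      using q(2) by (auto simp: gcd_3_eq_1_iff)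
    moreover have "D = 2 ^ 2 * 3 ^ 3 * m * p"
      by (simp add: q(1) m)
    ultimately have "D \<in> ?E1"
      using 1(1) by (intro CollectI exI[of _ m] exI[of _ p] conjI)
    then show ?thesis by blast
  next
    case 2
    then obtain m where m: "q = 16 * m" by blast
    then have "gcd m 6 = 1"
      using q(2) 2(2) by (auto simp: gcd_6_eq_1_iff)
    moreover have "D = 2 ^ 4 * 3 ^ 3 * m"
      by (simp add: q(1) m)
    ultimately have "D \<in> ?E2"
      by (intro CollectI exI[of _ m] conjI)
    then show ?thesis by blast
  next
    case 3
    then obtain m where m: "q = 64 * m" by blast
    then have "gcd m 3 = 1"
      using q(2) by (auto simp: gcd_3_eq_1_iff)
    moreover have "D = 2 ^ 6 * 3 ^ 3 * m"
      by (simp add: q(1) m)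
    ultimately have "D \<in> ?E3"
      by (intro CollectI exI[of _ m] conjI)
    then show ?thesis by blast
  qed
next
  fix D assume "D \<in> ?E1 \<union> ?E2 \<union> ?E3"
  \<comment> \<open>The shape 54k with k prime to 3 settles evenness and the exact power of 3 for
    all three families at once.\<close>
  then have "D \<in> integer_group_dets TYPE(18) \<and> (\<exists>k. D = 27 * (2 * k) \<and> \<not> 3 dvd k)"
  proof (elim UnE)
    assume "D \<in> ?E1"
    then obtain m p where "D = 2 ^ 2 * 3 ^ 3 * m * p" and p: "type1_prime p" and "gcd m 3 = 1"
      unfolding mem_Collect_eq by metis
    then have D: "D = 108 * m * p" and m: "\<not> 3 dvd m"
      unfolding gcd_3_eq_1_iff by simp_all
    obtain A B where AB: "p = eisenstein_norm (2 * (1 + 3 * B)) (3 * (1 + 2 * A))"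
      using p unfolding type1_prime_def by blast
    have "108 * p * (3 * h - 1) \<in> integer_group_dets TYPE(18)" for h
      using type1_even_dets[of h B A] unfolding AB[symmetric] by (simp only: mult_ac)
    from det_multiples_mod_3[OF this m] have "D \<in> integer_group_dets TYPE(18)"
      by (simp only: D mult_ac)
    moreover have "\<not> 3 dvd 2 * (m * p)"
      using m type1_prime_coprime_6[OF p] by (simp add: prime_dvd_mult_iff)
    moreover have "D = 27 * (2 * (2 * (m * p)))"
      by (simp add: D)
    ultimately show ?thesis by blast
  next
    assume "D \<in> ?E2"
    then obtain m where "D = 2 ^ 4 * 3 ^ 3 * m" "gcd m 6 = 1"
      unfolding mem_Collect_eq by metis
    then have D: "D = 432 * m" and m: "odd m" "\<not> 3 dvd m"
      unfolding gcd_6_eq_1_iff by simp_all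
    have "D \<in> integer_group_dets TYPE(18)"
      unfolding D by (rule det_multiples_mod_6[OF sixteen_dets m])
    moreover have "D = 27 * (2 * (8 * m))"
      by (simp add: D)
    moreover have "\<not> 3 dvd 8 * m"
      using m by presburger
    ultimately show ?thesis by blast
  next
    assume "D \<in> ?E3"
    then obtain m where "D = 2 ^ 6 * 3 ^ 3 * m" "gcd m 3 = 1"
      unfolding mem_Collect_eq by metis
    then have D: "D = 1728 * m" and m: "\<not> 3 dvd m"
      unfolding gcd_3_eq_1_iff by simp_all
    have "D \<in> integer_group_dets TYPE(18)"
      unfolding D by (rule det_multiples_mod_3[OF sixty_four_dets m])
    moreover have "D = 27 * (2 * (32 * m))"
      by (simp add: D)
    moreover have "\<not> 3 dvd 32 * m"
      using m by presburger
    ultimately show ?thesis by blast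
  qed
  moreover have "\<not> 81 dvd 27 * (2 * k)" if "\<not> 3 dvd k" for k :: int
    using that by presburger
  ultimately show "D \<in> ?E"
    by auto
qed

end
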